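(* There is an absolute constant $c$ such that for every $n\ge1$, the geometric Ramsey number of the ladder graph satisfies $R_g(L_{2n})\le c\,n^{10}$.
   Context: A finite point set $P\subset\mathbb{R}^2$ is in general position if no three points are collinear. $K_P$ is the complete graph on $P$ with edges drawn as straight segments. A monochromatic non-crossing copy of a graph $G$ in a $2$-colouring of $K_P$ is an injective map $\phi:V(G)\to P$ such that all segments $\phi(x)\phi(y)$, $xy\in E(G)$, have the same colour and no two share a point other than a common endpoint. The geometric Ramsey number $R_g(G)$ is the smallest $N$ such that for every set $P$ of $N$ points in general position, every $2$-colouring of the edges of $K_P$ contains a monochromatic non-crossing copy of $G$. The ladder graph $L_{2n}$ consists of two paths $u_1\cdots u_n$ and $v_1\cdots v_n$ plus the edges $u_iv_i$, $i\in[n]$. *)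

theory Defs
  imports "HOL-Analysis.Analysis"
begin

type_synonym point = "real \<times> real"

definition general_position :: "point set \<Rightarrow> bool" where
  "general_position P \<longleftrightarrow>
     (\<forall>a\<in>P. \<forall>b\<in>P. \<forall>c\<in>P. a \<noteq> b \<and> a \<noteq> c \<and> b \<noteq> c \<longrightarrow> \<not> collinear {a, b, c})"

text \<open>A graph is given by a vertex set V and a set E of edges, each edge a pair (x,y)
  of distinct vertices of V, read as the unordered edge {x,y}.  A 2-colouring of K_P
  is a function chi assigning a colour (bool) to each 2-element set {p,q} of points.
  A monochromatic non-crossing copy: an injective map phi from V into P such that all
  edge segments have the same colour and two distinct edges' segments meet only in
  images of common endpoints.\<close>
definition mono_noncrossing_copy ::
  "'v set \<Rightarrow> ('v \<times> 'v) set \<Rightarrow> point set \<Rightarrow> (point set \<Rightarrow> bool) \<Rightarrow> ('v \<Rightarrow> point) \<Rightarrow> bool" where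
  "mono_noncrossing_copy V E P chi phi \<longleftrightarrow>
     inj_on phi V \<and> phi ` V \<subseteq> P \<and>
     (\<exists>col. \<forall>(x, y)\<in>E. chi {phi x, phi y} = col) \<and>
     (\<forall>(x, y)\<in>E. \<forall>(u, w)\<in>E. {x, y} \<noteq> {u, w} \<longrightarrow>
        closed_segment (phi x) (phi y) \<inter> closed_segment (phi u) (phi w)
          \<subseteq> phi ` ({x, y} \<inter> {u, w}))"

definition geometric_ramsey_property :: "'v set \<Rightarrow> ('v \<times> 'v) set \<Rightarrow> nat \<Rightarrow> bool" where
  "geometric_ramsey_property V E N \<longleftrightarrow>
     (\<forall>P :: point set. finite P \<and> card P = N \<and> general_position P \<longrightarrow>
        (\<forall>chi :: point set \<Rightarrow> bool. \<exists>phi. mono_noncrossing_copy V E P chi phi))"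

definition geometric_ramsey :: "'v set \<Rightarrow> ('v \<times> 'v) set \<Rightarrow> nat" where
  "geometric_ramsey V E = (LEAST N. geometric_ramsey_property V E N)"

text \<open>Ladder L_{2n}: vertices (False,i) = u_i and (True,i) = v_i for i in [n].\<close>
definition ladder_V :: "nat \<Rightarrow> (bool \<times> nat) set" where
  "ladder_V n = UNIV \<times> {1..n}"

definition ladder_E :: "nat \<Rightarrow> ((bool \<times> nat) \<times> (bool \<times> nat)) set" where
  "ladder_E n = {((b, i), (b, i + 1)) | b i. 1 \<le> i \<and> i < n}
              \<union> {((False, i), (True, i)) | i. 1 \<le> i \<and> i \<le> n}"

end

theory Submission
  imports Defs
begin

text \<open>
  In an \<open>avoiding_pair\<close>, every \<open>b l\<close> sees all \<open>a i\<close> in counterclockwise order and every \<open>a l\<close>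
  sees all \<open>b i\<close> in clockwise order.  Then paths with increasing indices on both sides, joined by
  rungs between corresponding vertices, are noncrossing.  Any two linearly separated sets of
  \<open>16 k\<^sup>2\<close> points contain such a pair with \<open>k\<close> points on each side, by a ham-sandwich cut
  followed by two applications of the Erdos-Szekeres argument.

  Suppose there is no monochromatic ladder.  Since every \<open>2 n\<close> points admit a noncrossing ladder,
  both colours occur on every \<open>2 n\<close> points, so every long sequence contains increasing paths of \<open>n\<close>
  vertices in either colour; hence no avoiding pair of size \<open>2 n\<^sup>2\<close> has all its rungs of one
  colour.  In an avoiding pair of size \<open>m\<close>, consider the rungs of the majority colour, ordered by
  "can be followed by, in a ladder of that colour".  There is no chain of length \<open>n\<close>, so
  \<open>m\<^sup>2 / (2 n)\<close> rungs are pairwise unrelated.  An averaging argument gives indices \<open>i < i'\<close> such that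
  \<open>a i, a i'\<close> has the majority colour and, for some \<open>c\<close>, many unrelated rungs at \<open>a i\<close> end below
  \<open>c\<close> and many at \<open>a i'\<close> end above \<open>c\<close>.  Being unrelated forces all edges between these two sets of
  ends to have the other colour, and each set has order \<open>n\<^sup>4\<close> points, which yields a forbidden
  pair of size \<open>2 n\<^sup>2\<close>.  This works for \<open>m\<close> of order \<open>n\<^sup>5\<close>, and \<open>32 m\<^sup>2\<close> points contain an
  avoiding pair of size \<open>m\<close>.
\<close>

section \<open>Orientation of triples and noncrossing ladders\<close>

definition cross2 :: "point \<Rightarrow> point \<Rightarrow> real" where
  "cross2 u v = fst u * snd v - snd u * fst v"

text \<open>Twice the signed area of the triangle \<open>p q r\<close>, positive exactly for a
  counterclockwise turn.\<close>

definition orient :: "point \<Rightarrow> point \<Rightarrow> point \<Rightarrow> real" where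
  "orient p q r = cross2 (q - p) (r - p)"

lemma orient_rotate: "orient p q r = orient q r p"
  by (simp add: orient_def cross2_def algebra_simps)

lemma orient_swap: "orient p r q = - orient p q r"
  by (simp add: orient_def cross2_def algebra_simps)

lemma orient_same [simp]: "orient p p q = 0" "orient p q p = 0" "orient p q q = 0"
  by (simp_all add: orient_def cross2_def algebra_simps)

section \<open>Segments tested against lines\<close>

lemma orient_affine:
  "orient p q ((1 - u) *\<^sub>R x + u *\<^sub>R y) = (1 - u) * orient p q x + u * orient p q y"
  by (simp add: orient_def cross2_def algebra_simps)

lemma orient_segment_pos:
  assumes "z \<in> closed_segment x y" "orient p q x > 0" "orient p q y > 0"
  shows "orient p q z > 0"
proof -
  obtain u where u: "0 \<le> u" "u \<le> 1" "z = (1 - u) *\<^sub>R x + u *\<^sub>R y"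
    using assms(1) by (auto simp: in_segment)
  show ?thesis
  proof (cases "u = 0")
    case False
    then have "u * orient p q y > 0" using u assms by simp
    moreover have "(1 - u) * orient p q x \<ge> 0" using u assms by simp
    ultimately show ?thesis using u by (simp add: orient_affine)
  qed (use u assms in simp)
qed

lemma orient_segment_neg:
  assumes "z \<in> closed_segment x y" "orient p q x < 0" "orient p q y < 0"
  shows "orient p q z < 0"
proof -
  have "orient q p w = - orient p q w" for w
    by (simp add: orient_def cross2_def algebra_simps)
  then show ?thesis using orient_segment_pos[of z x y q p] assms by simp
qed

text \<open>The affine function \<open>orient p q\<close> is nonzero at \<open>x\<close> and zero at
  \<open>y\<close>, so along the segment it vanishes only at \<open>y\<close>.\<close>

lemma orient_segment_end:
  assumes "z \<in> closed_segment x y" "orient p q x \<noteq> 0" "orient p q y = 0" "orient p q z = 0"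
  shows "z = y"
proof -
  obtain u where u: "0 \<le> u" "u \<le> 1" "z = (1 - u) *\<^sub>R x + u *\<^sub>R y"
    using assms(1) by (auto simp: in_segment)
  then have "(1 - u) * orient p q x = 0" using assms by (simp add: orient_affine)
  then have "u = 1" using assms by simp
  then show ?thesis using u by simp
qed

lemma orient_on_segment: "z \<in> closed_segment x y \<Longrightarrow> orient x y z = 0"
  by (auto simp: in_segment orient_affine)

lemma segments_disjoint_same_side:
  assumes "orient a b c < 0 \<and> orient a b d < 0 \<or> orient a b c > 0 \<and> orient a b d > 0"
  shows "closed_segment a b \<inter> closed_segment c d = {}"
  using assms orient_segment_pos[of _ c d a b] orient_segment_neg[of _ c d a b]
    orient_on_segment[of _ a b] by fastforce

lemma segments_meet_at_common_end:
  assumes "orient a b c \<noteq> 0"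
  shows "closed_segment a b \<inter> closed_segment a c \<subseteq> {a}"
proof
  fix z assume z: "z \<in> closed_segment a b \<inter> closed_segment a c"
  then have "orient a b z = 0" by (simp add: orient_on_segment)
  moreover have "z \<in> closed_segment c a" using z by (simp add: closed_segment_commute)
  ultimately show "z \<in> {a}" using orient_segment_end[of z c a a b] assms by simp
qed

text \<open>A vanishing determinant makes \<open>c - a\<close> a multiple of \<open>b - a\<close>.
  Apart from passing to subsets, general position is used only through this lemma.\<close>

lemma orient_nonzero_if_general_position:
  assumes "general_position P" "a \<in> P" "b \<in> P" "c \<in> P" "a \<noteq> b" "a \<noteq> c" "b \<noteq> c"
  shows "orient a b c \<noteq> 0"
proof
  assume 0: "orient a b c = 0"
  define u v where "u = b - a" and "v = c - a"
  have uv: "fst u * snd v = snd u * fst v" using 0 by (simp add: orient_def cross2_def u_def v_def)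
  have "u \<noteq> 0" using assms by (simp add: u_def)
  then have nz: "fst u \<noteq> 0 \<or> snd u \<noteq> 0" by (simp add: prod_eq_iff)
  have "\<exists>k. v = k *\<^sub>R u"
  proof (cases "fst u = 0")
    case True
    then show ?thesis using nz uv
      by (intro exI[of _ "snd v / snd u"]) (auto simp: prod_eq_iff)
  next
    case False
    then show ?thesis using uv
      by (intro exI[of _ "fst v / fst u"]) (auto simp: prod_eq_iff field_simps)
  qed
  then have "collinear {0, u, v}" by (auto simp: collinear_lemma)
  then have "collinear {b, a, c}" by (simp add: collinear_3 u_def v_def)
  then show False using assms unfolding general_position_def by (metis insert_commute)
qed

text \<open>Pure geometry without colours, indexed from 0. By injectivity, each intersection of
  vertex sets on a right-hand side is empty unless the two edges share that vertex.\<close>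

definition ladder_drawing :: "nat \<Rightarrow> (bool \<Rightarrow> nat \<Rightarrow> point) \<Rightarrow> bool" where
  "ladder_drawing n c \<longleftrightarrow>
     inj_on (\<lambda>(s, i). c s i) (UNIV \<times> {..<n}) \<and>
     (\<forall>s i j. i < j \<and> Suc j < n \<longrightarrow>
        closed_segment (c s i) (c s (Suc i)) \<inter> closed_segment (c s j) (c s (Suc j))
          \<subseteq> {c s (Suc i)} \<inter> {c s j}) \<and>
     (\<forall>i j. Suc i < n \<and> Suc j < n \<longrightarrow>
        closed_segment (c False i) (c False (Suc i))
          \<inter> closed_segment (c True j) (c True (Suc j)) = {}) \<and>
     (\<forall>s i j. Suc i < n \<and> j < n \<longrightarrow>
        closed_segment (c s i) (c s (Suc i)) \<inter> closed_segment (c False j) (c True j)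
          \<subseteq> {c s i, c s (Suc i)} \<inter> {c s j}) \<and>
     (\<forall>i j. i < j \<and> j < n \<longrightarrow>
        closed_segment (c False i) (c True i) \<inter> closed_segment (c False j) (c True j) = {})"

lemma mono_noncrossing_copyI:
  assumes "inj_on phi V" "phi ` V \<subseteq> P"
    and "\<And>x y. (x, y) \<in> E \<Longrightarrow> chi {phi x, phi y} = col"
    and "\<And>x y u w. (x, y) \<in> E \<Longrightarrow> (u, w) \<in> E \<Longrightarrow> {x, y} \<noteq> {u, w} \<Longrightarrow>
      closed_segment (phi x) (phi y) \<inter> closed_segment (phi u) (phi w) \<subseteq> phi ` ({x, y} \<inter> {u, w})"
  shows "mono_noncrossing_copy V E P chi phi"
proof -
  have 3: "\<forall>(x, y)\<in>E. chi {phi x, phi y} = col"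
    using assms(3) by (intro ballI case_prodI2) simp
  have 4: "\<forall>(x, y)\<in>E. \<forall>(u, w)\<in>E. {x, y} \<noteq> {u, w} \<longrightarrow>
    closed_segment (phi x) (phi y) \<inter> closed_segment (phi u) (phi w) \<subseteq> phi ` ({x, y} \<inter> {u, w})"
  proof (rule ballI, rule case_prodI2, rule ballI, rule case_prodI2, rule impI)
    fix e f x y u w
    assume "e \<in> E" "e = (x, y)" "f \<in> E" "f = (u, w)" "{x, y} \<noteq> {u, w}"
    then show "closed_segment (phi x) (phi y) \<inter> closed_segment (phi u) (phi w)
        \<subseteq> phi ` ({x, y} \<inter> {u, w})"
      by (intro assms(4)) simp_all
  qed
  show ?thesis unfolding mono_noncrossing_copy_def
    by (intro conjI exI[of _ col] assms(1,2) 3 4)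
qed

text \<open>The shift \<open>i - 1\<close> matches the ladder labels \<open>1..n\<close> with the
  indices \<open>0..n-1\<close> of the drawing.\<close>

lemma ladder_drawing_copy:
  assumes d: "ladder_drawing n c"
    and P: "\<And>s i. i < n \<Longrightarrow> c s i \<in> P"
    and side: "\<And>s i. Suc i < n \<Longrightarrow> chi {c s i, c s (Suc i)} = col"
    and rung: "\<And>i. i < n \<Longrightarrow> chi {c False i, c True i} = col"
  shows "mono_noncrossing_copy (ladder_V n) (ladder_E n) P chi (\<lambda>(s, i). c s (i - 1))"
    (is "mono_noncrossing_copy _ _ _ _ ?phi")
proof -
  let ?seg = "\<lambda>s i t j. closed_segment (c s i) (c t j)"
  note D = d[unfolded ladder_drawing_def]
  have inj0: "c s i = c t j \<longleftrightarrow> s = t \<and> i = j" if "i < n" "j < n" for s t i j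
    using inj_on_eq_iff[OF D[THEN conjunct1], of "(s, i)" "(t, j)"] that by simp
  have inj: "inj_on ?phi (ladder_V n)"
  proof (rule inj_onI)
    fix x y assume V: "x \<in> ladder_V n" "y \<in> ladder_V n" and eq: "?phi x = ?phi y"
    obtain s i t j where xy: "x = (s, i)" "y = (t, j)" by (metis surj_pair)
    have "1 \<le> i" "i \<le> n" "1 \<le> j" "j \<le> n" using V xy by (auto simp: ladder_V_def)
    moreover from this have "s = t \<and> i - 1 = j - 1"
      using eq inj0[of "i - 1" "j - 1" s t] by (simp add: xy)
    ultimately have "i = j" "s = t" by auto
    then show "x = y" using xy by simp
  qed
  \<comment> \<open>Every ladder edge is a side edge or a rung; writing its labels with
    \<open>Suc\<close> makes the shift cancel.\<close>
  have E: "(\<exists>s i. Suc i < n \<and> e = ((s, Suc i), (s, Suc (Suc i)))) \<or>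
      (\<exists>i < n. e = ((False, Suc i), (True, Suc i)))" if "e \<in> ladder_E n" for e
  proof -
    from that consider s i where "1 \<le> i" "i < n" "e = ((s, i), (s, i + 1))"
      | i where "1 \<le> i" "i \<le> n" "e = ((False, i), (True, i))"
      unfolding ladder_E_def by blast
    then show ?thesis
    proof cases
      case (1 s i)
      then show ?thesis by (intro disjI1 exI[of _ s] exI[of _ "i - 1"]) auto
    next
      case (2 i)
      then show ?thesis by (intro disjI2 exI[of _ "i - 1"]) auto
    qed
  qed
  have EV: "x \<in> ladder_V n" "y \<in> ladder_V n" if "(x, y) \<in> ladder_E n" for x y
    using that unfolding ladder_E_def ladder_V_def by auto
  have d1: "?seg s i s (Suc i) \<inter> ?seg s j s (Suc j) \<subseteq> {c s (Suc i)} \<inter> {c s j}"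
    if "i < j" "Suc j < n" for s i j
    using D[THEN conjunct2, THEN conjunct1] that by blast
  have d2: "?seg False i False (Suc i) \<inter> ?seg True j True (Suc j) = {}"
    if "Suc i < n" "Suc j < n" for i j
    using D[THEN conjunct2, THEN conjunct2, THEN conjunct1] that by blast
  have d3: "?seg s i s (Suc i) \<inter> ?seg False j True j \<subseteq> {c s i, c s (Suc i)} \<inter> {c s j}"
    if "Suc i < n" "j < n" for s i j
    using D[THEN conjunct2, THEN conjunct2, THEN conjunct2, THEN conjunct1] that by blast
  have d4: "?seg False i True i \<inter> ?seg False j True j = {}" if "i < j" "j < n" for i j
    using D[THEN conjunct2, THEN conjunct2, THEN conjunct2, THEN conjunct2] that by blast
  \<comment> \<open>The clauses of the drawing are brought into one symmetric form: two different
    edges meet only in points that are endpoints of both.\<close>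
  have ss: "?seg s i s (Suc i) \<inter> ?seg t j t (Suc j) \<subseteq> {c s i, c s (Suc i)} \<inter> {c t j, c t (Suc j)}"
    if "Suc i < n" "Suc j < n" "(s, i) \<noteq> (t, j)" for s t i j
  proof (cases "s = t")
    case True
    then have "i \<noteq> j" using that(3) by simp
    then consider "i < j" | "j < i" by linarith
    then show ?thesis
    proof cases
      case 1
      from d1[OF this that(2), of s] show ?thesis using True by blast
    next
      case 2
      from d1[OF this that(1), of s] show ?thesis using True by blast
    qed
  next
    case False
    then have "?seg s i s (Suc i) \<inter> ?seg t j t (Suc j) = {}"
      using d2[OF that(1,2)] d2[OF that(2,1)] by (cases s; cases t) auto
    then show ?thesis by simp
  qed
  have sr: "?seg s i s (Suc i) \<inter> ?seg False j True j \<subseteq> {c s i, c s (Suc i)} \<inter> {c False j, c True j}"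
    if "Suc i < n" "j < n" for s i j
    using d3[OF that, of s] by (cases s) auto
  have rr: "?seg False i True i \<inter> ?seg False j True j = {}" if "i < n" "j < n" "i \<noteq> j" for i j
    using d4[of i j] d4[of j i] that by (metis Int_commute linorder_neqE_nat)
  have nc: "closed_segment (?phi x) (?phi y) \<inter> closed_segment (?phi u) (?phi w)
      \<subseteq> {?phi x, ?phi y} \<inter> {?phi u, ?phi w}"
    if "(x, y) \<in> ladder_E n" "(u, w) \<in> ladder_E n" "{x, y} \<noteq> {u, w}" for x y u w
    using E[OF that(1)]
  proof (elim disjE exE conjE)
    fix s i assume i: "Suc i < n" and e: "(x, y) = ((s, Suc i), (s, Suc (Suc i)))"
    show ?thesis using E[OF that(2)]
    proof (elim disjE exE conjE)
      fix t j assume j: "Suc j < n" and f: "(u, w) = ((t, Suc j), (t, Suc (Suc j)))"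
      have "(s, i) \<noteq> (t, j)" using that(3) e f by auto
      from ss[OF i j this] show ?thesis using e f by simp
    next
      fix j assume "j < n" "(u, w) = ((False, Suc j), (True, Suc j))"
      then show ?thesis using sr[OF i, of j s] e by simp
    qed
  next
    fix i assume i: "i < n" and e: "(x, y) = ((False, Suc i), (True, Suc i))"
    show ?thesis using E[OF that(2)]
    proof (elim disjE exE conjE)
      fix t j assume "Suc j < n" "(u, w) = ((t, Suc j), (t, Suc (Suc j)))"
      then show ?thesis using sr[of j i t] i e by (simp add: Int_commute)
    next
      fix j assume j: "j < n" and f: "(u, w) = ((False, Suc j), (True, Suc j))"
      have "i \<noteq> j" using that(3) e f by auto
      from rr[OF i j this] show ?thesis using e f by simp
    qed
  qed
  \<comment> \<open>\<open>nc\<close> bounds by an intersection of images; injectivity of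
    \<open>?phi\<close> turns it into the image of an intersection.\<close>
  have nc': "closed_segment (?phi x) (?phi y) \<inter> closed_segment (?phi u) (?phi w)
      \<subseteq> ?phi ` ({x, y} \<inter> {u, w})"
    if "(x, y) \<in> ladder_E n" "(u, w) \<in> ladder_E n" "{x, y} \<noteq> {u, w}" for x y u w
  proof -
    have "?phi ` ({x, y} \<inter> {u, w}) = ?phi ` {x, y} \<inter> ?phi ` {u, w}"
      using EV[OF that(1)] EV[OF that(2)] by (intro inj_on_image_Int[OF inj]) auto
    then show ?thesis using nc[OF that] by simp
  qed
  have col: "chi {?phi x, ?phi y} = col" if "(x, y) \<in> ladder_E n" for x y
    using E[OF that] by (elim disjE exE conjE) (auto simp: side rung)
  have "?phi ` ladder_V n \<subseteq> P" by (auto simp: ladder_V_def intro!: P)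
  then show ?thesis
    by (rule mono_noncrossing_copyI[of ?phi "ladder_V n" P "ladder_E n" chi col, OF inj _ col nc'])
qed

text \<open>Each line through two points of one row has the whole other row strictly on one side:
  these are mutually avoiding sets, with the order of both rows fixed.\<close>

definition avoiding_pair :: "nat \<Rightarrow> (nat \<Rightarrow> point) \<Rightarrow> (nat \<Rightarrow> point) \<Rightarrow> bool" where
  "avoiding_pair m a b \<longleftrightarrow>
     (\<forall>i j l. i < j \<longrightarrow> j < m \<longrightarrow> l < m \<longrightarrow>
        orient (b l) (a i) (a j) > 0 \<and> orient (a l) (b i) (b j) < 0)"

lemma avoiding_pair_inj:
  assumes "avoiding_pair m a b" "i < m" "j < m"
  shows "a i = a j \<longleftrightarrow> i = j" "b i = b j \<longleftrightarrow> i = j"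
proof -
  have "a i \<noteq> a j \<and> b i \<noteq> b j" if "i < j" "j < m" for i j
    using assms(1) that unfolding avoiding_pair_def by (metis orient_same(3) less_irrefl)
  from this[of i j] this[of j i] show "a i = a j \<longleftrightarrow> i = j" "b i = b j \<longleftrightarrow> i = j"
    using assms by (metis linorder_neqE_nat)+
qed

lemma avoiding_pair_sub:
  assumes ab: "avoiding_pair m a b"
    and f: "\<And>i j. i < j \<Longrightarrow> j < n \<Longrightarrow> f i < f j" "\<And>i. i < n \<Longrightarrow> f i < m"
    and g: "\<And>i j. i < j \<Longrightarrow> j < n \<Longrightarrow> g i < g j" "\<And>i. i < n \<Longrightarrow> g i < m"
  shows "avoiding_pair n (a \<circ> f) (b \<circ> g)"
  using assms unfolding avoiding_pair_def by simp

text \<open>The line from \<open>v\<close> through \<open>a j\<close> separates the edges: the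
  earlier one lies weakly on its negative side, the later one weakly on its positive side.\<close>

lemma monotone_path_noncrossing:
  assumes mono: "\<And>i j. i < j \<Longrightarrow> j < n \<Longrightarrow> orient v (a i) (a j) > 0"
    and ij: "i < j" "Suc j < n"
  shows "closed_segment (a i) (a (Suc i)) \<inter> closed_segment (a j) (a (Suc j)) \<subseteq> {a (Suc i)} \<inter> {a j}"
proof
  fix z assume z: "z \<in> closed_segment (a i) (a (Suc i)) \<inter> closed_segment (a j) (a (Suc j))"
  show "z \<in> {a (Suc i)} \<inter> {a j}"
  proof (cases "j = Suc i")
    case True
    obtain u where u: "0 \<le> u" "u \<le> 1" "z = (1 - u) *\<^sub>R a i + u *\<^sub>R a j"
      using z True by (auto simp: in_segment)
    obtain w where w: "0 \<le> w" "w \<le> 1" "z = (1 - w) *\<^sub>R a j + w *\<^sub>R a (Suc j)"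
      using z by (auto simp: in_segment)
    have "orient v (a j) z = (1 - u) * orient v (a j) (a i)" by (simp add: u(3) orient_affine)
    moreover have "orient v (a j) z = w * orient v (a j) (a (Suc j))" by (simp add: w(3) orient_affine)
    moreover have "w * orient v (a j) (a (Suc j)) \<ge> 0"
      using w ij mono[of j "Suc j"] by simp
    moreover have neg: "orient v (a j) (a i) < 0" using mono[of i j] ij by (simp add: orient_swap[of v "a j"])
    ultimately have "(1 - u) * orient v (a j) (a i) \<ge> 0" by simp
    then have "u = 1" using neg u by (simp add: zero_le_mult_iff)
    then show ?thesis using u True by simp
  next
    case False
    then have lt: "Suc i < j" using ij by simp
    then have "orient v z (a j) > 0"
    proof -
      have "orient (a j) v z > 0"
        by (rule orient_segment_pos[of z "a i" "a (Suc i)"])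
          (use z ij lt mono[of i j] mono[of "Suc i" j] in \<open>auto simp: orient_rotate[of "a j"]\<close>)
      then show ?thesis by (simp add: orient_rotate[of "a j"])
    qed
    then have neg: "orient v (a j) z < 0" by (simp add: orient_swap[of v "a j"])
    obtain w where w: "0 \<le> w" "w \<le> 1" "z = (1 - w) *\<^sub>R a j + w *\<^sub>R a (Suc j)"
      using z by (auto simp: in_segment)
    have "orient v (a j) z = w * orient v (a j) (a (Suc j))" by (simp add: w(3) orient_affine)
    moreover have "w * orient v (a j) (a (Suc j)) \<ge> 0" using w ij mono[of j "Suc j"] by simp
    ultimately show ?thesis using neg by simp
  qed
qed

text \<open>Swapping the coordinates is a linear reflection that reverses all orientations, which
  reduces this to the counterclockwise case.\<close>

lemma monotone_path_noncrossing_clockwise: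
  assumes mono: "\<And>i j. i < j \<Longrightarrow> j < n \<Longrightarrow> orient v (a i) (a j) < 0"
    and ij: "i < j" "Suc j < n"
  shows "closed_segment (a i) (a (Suc i)) \<inter> closed_segment (a j) (a (Suc j)) \<subseteq> {a (Suc i)} \<inter> {a j}"
proof -
  define r :: "point \<Rightarrow> point" where "r = prod.swap"
  have lin: "linear r" unfolding r_def by (intro linearI) auto
  have inj: "inj r" by (auto simp: r_def inj_def prod_eq_iff)
  have or: "orient (r x) (r y) (r z) = - orient x y z" for x y z
    by (simp add: orient_def cross2_def r_def)
  have "closed_segment (r (a i)) (r (a (Suc i))) \<inter> closed_segment (r (a j)) (r (a (Suc j)))
      \<subseteq> {r (a (Suc i))} \<inter> {r (a j)}"
    using monotone_path_noncrossing[of n "r v" "\<lambda>i. r (a i)" i j] mono ij by (simp add: or)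
  then have "r ` (closed_segment (a i) (a (Suc i)) \<inter> closed_segment (a j) (a (Suc j)))
      \<subseteq> r ` ({a (Suc i)} \<inter> {a j})"
    by (simp add: closed_segment_linear_image[OF lin] image_Int[OF inj])
  then show ?thesis using inj by (simp add: inj_image_subset_iff)
qed

text \<open>The line from \<open>a j\<close> to \<open>b j\<close> has all later vertices of both
  rows on its negative side and all earlier ones on its positive side, and the line of an
  \<open>a\<close>-edge has all of \<open>b\<close> on one side. The two paths are monotone as seen
  from a point of the other row.\<close>

lemma avoiding_pair_ladder_drawing:
  assumes ab: "avoiding_pair n a b" and ne: "\<And>i j. i < n \<Longrightarrow> j < n \<Longrightarrow> a i \<noteq> b j"
  shows "ladder_drawing n (\<lambda>s. if s then b else a)" (is "ladder_drawing n ?c")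
proof -
  have A1: "orient (b l) (a i) (a j) > 0" if "i < j" "j < n" "l < n" for i j l
    using ab that unfolding avoiding_pair_def by blast
  have A2: "orient (a i) (b l) (a j) < 0" "orient (a j) (b l) (a i) > 0"
      "orient (a i) (a j) (b l) > 0" if "i < j" "j < n" "l < n" for i j l
    using A1[OF that] orient_rotate[of "b l" "a i" "a j"] orient_rotate[of "b l" "a j" "a i"]
      orient_swap[of "a i" "a j" "b l"] orient_swap[of "b l" "a j" "a i"]
      orient_rotate[of "a j" "b l" "a i"]
    by linarith+
  have B1: "orient (a l) (b i) (b j) < 0" if "i < j" "j < n" "l < n" for i j l
    using ab that unfolding avoiding_pair_def by blast
  have B2: "orient (a l) (b j) (b i) > 0" "orient (b i) (b j) (a l) < 0"
    if "i < j" "j < n" "l < n" for i j l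
    using B1[OF that] orient_rotate[of "a l" "b i" "b j"] orient_swap[of "a l" "b j" "b i"]
    by linarith+
  have aa: "closed_segment (a i) (a (Suc i)) \<inter> closed_segment (a j) (a (Suc j)) \<subseteq> {a (Suc i)} \<inter> {a j}"
    if "i < j" "Suc j < n" for i j
    using that by (intro monotone_path_noncrossing[of n "b 0"] A1) auto
  have bb: "closed_segment (b i) (b (Suc i)) \<inter> closed_segment (b j) (b (Suc j)) \<subseteq> {b (Suc i)} \<inter> {b j}"
    if "i < j" "Suc j < n" for i j
    using that by (intro monotone_path_noncrossing_clockwise[of n "a 0"] B1) auto
  have ab0: "closed_segment (a i) (a (Suc i)) \<inter> closed_segment (b j) (b (Suc j)) = {}"
    if "Suc i < n" "Suc j < n" for i j
    using that by (intro segments_disjoint_same_side disjI2 conjI A2) auto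
  have ar: "closed_segment (a i) (a (Suc i)) \<inter> closed_segment (a j) (b j) \<subseteq> {a i, a (Suc i)} \<inter> {a j}"
    if "Suc i < n" "j < n" for i j
  proof -
    consider "j < i" | "j = i" | "j = Suc i" | "Suc i < j" by linarith
    then show ?thesis
    proof cases
      case 1
      then have "closed_segment (a j) (b j) \<inter> closed_segment (a i) (a (Suc i)) = {}"
        using that by (intro segments_disjoint_same_side disjI1 conjI A2) auto
      then show ?thesis by blast
    next
      case 2
      have "closed_segment (a i) (a (Suc i)) \<inter> closed_segment (a i) (b i) \<subseteq> {a i}"
        using that A2(3)[of i "Suc i" i] by (intro segments_meet_at_common_end) auto
      then show ?thesis using 2 by blast
    next
      case 3
      have "closed_segment (a j) (b j) \<inter> closed_segment (a j) (a i) \<subseteq> {a j}"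
        using that 3 A2(2)[of i j j] by (intro segments_meet_at_common_end) auto
      then show ?thesis using 3 by (auto simp: closed_segment_commute)
    next
      case 4
      then have "closed_segment (a j) (b j) \<inter> closed_segment (a i) (a (Suc i)) = {}"
        using that by (intro segments_disjoint_same_side disjI2 conjI A2) auto
      then show ?thesis by blast
    qed
  qed
  have br: "closed_segment (b i) (b (Suc i)) \<inter> closed_segment (a j) (b j) \<subseteq> {b i, b (Suc i)} \<inter> {b j}"
    if "Suc i < n" "j < n" for i j
  proof -
    consider "j < i" | "j = i" | "j = Suc i" | "Suc i < j" by linarith
    then show ?thesis
    proof cases
      case 1
      then have "closed_segment (a j) (b j) \<inter> closed_segment (b i) (b (Suc i)) = {}"
        using that by (intro segments_disjoint_same_side disjI1 conjI B1) auto
      then show ?thesis by blast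
    next
      case 2
      have "closed_segment (b i) (b (Suc i)) \<inter> closed_segment (b i) (a i) \<subseteq> {b i}"
        using that B2(2)[of i "Suc i" i] by (intro segments_meet_at_common_end) auto
      then show ?thesis using 2 by (auto simp: closed_segment_commute)
    next
      case 3
      have "closed_segment (b j) (b i) \<inter> closed_segment (b j) (a j) \<subseteq> {b j}"
        using that 3 B2(2)[of i j j] orient_rotate[of "a j" "b j" "b i"] B2(1)[of i j j]
        by (intro segments_meet_at_common_end) auto
      then show ?thesis using 3 by (auto simp: closed_segment_commute)
    next
      case 4
      then have "closed_segment (a j) (b j) \<inter> closed_segment (b i) (b (Suc i)) = {}"
        using that by (intro segments_disjoint_same_side disjI2 conjI B2) auto
      then show ?thesis by blast
    qed
  qed
  have rr: "closed_segment (a i) (b i) \<inter> closed_segment (a j) (b j) = {}"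
    if "i < j" "j < n" for i j
    using that by (intro segments_disjoint_same_side disjI1 conjI A2 B1) auto
  have inj: "inj_on (\<lambda>(s, i). ?c s i) (UNIV \<times> {..<n})"
    using ne ne[symmetric] avoiding_pair_inj[OF ab] by (auto simp: inj_on_def split: if_splits)
  show ?thesis unfolding ladder_drawing_def
    using inj aa bb ab0 ar br rr by (simp add: all_bool_eq)
qed

section \<open>Chains and independent sets\<close>

text \<open>Mirsky's argument: the elements without an \<open>R\<close>-predecessor in
  \<open>I\<close> are independent. If they are fewer than \<open>l\<close>, removing them costs one
  chain element, and the head of any chain in the rest has a predecessor in \<open>I\<close> that
  can be prepended. Only consecutive elements of the chain are related, so \<open>R\<close> may be
  any relation.\<close>

lemma chain_or_independent:
  assumes "finite I" "k * l \<le> card I" "0 < l"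
  shows "(\<exists>xs. length xs = k \<and> set xs \<subseteq> I \<and> successively R xs) \<or>
    (\<exists>D\<subseteq>I. l \<le> card D \<and> (\<forall>x\<in>D. \<forall>y\<in>D. \<not> R x y))"
  using assms
proof (induction k arbitrary: I)
  case 0
  then show ?case by simp
next
  case (Suc k)
  define D where "D = {x \<in> I. \<forall>y\<in>I. \<not> R y x}"
  show ?case
  proof (cases "l \<le> card D")
    case True
    moreover have "D \<subseteq> I" "\<forall>x\<in>D. \<forall>y\<in>D. \<not> R x y" by (auto simp: D_def)
    ultimately show ?thesis by blast
  next
    case False
    have fD: "finite D" "D \<subseteq> I" using Suc.prems by (auto simp: D_def)
    then have card: "card (I - D) = card I - card D" by (simp add: card_Diff_subset)
    then have "k * l \<le> card (I - D)" "card (I - D) > 0" using Suc.prems False by auto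
    then obtain z where z: "z \<in> I - D" by (metis card_gt_0_iff ex_in_conv)
    have "finite (I - D)" using Suc.prems by simp
    from Suc.IH[OF this \<open>k * l \<le> card (I - D)\<close> \<open>0 < l\<close>] show ?thesis
    proof
      assume "\<exists>xs. length xs = k \<and> set xs \<subseteq> I - D \<and> successively R xs"
      then obtain xs where xs: "length xs = k" "set xs \<subseteq> I - D" "successively R xs" by blast
      show ?thesis
      proof (cases xs)
        \<comment> \<open>Here \<open>k = 0\<close>, and any remaining element is a chain of length
          one.\<close>
        case Nil
        then show ?thesis using xs z by (intro disjI1 exI[of _ "[z]"]) auto
      next
        case (Cons x ys)
        then obtain y where "y \<in> I" "R y x" using xs(2) by (auto simp: D_def)
        then show ?thesis using xs Cons by (intro disjI1 exI[of _ "y # xs"]) auto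
      qed
    next
      assume "\<exists>E\<subseteq>I - D. l \<le> card E \<and> (\<forall>x\<in>E. \<forall>y\<in>E. \<not> R x y)"
      then show ?thesis by blast
    qed
  qed
qed

text \<open>With \<open>R\<close> a colour this yields monochromatic paths with increasing indices;
  with \<open>R\<close> a comparison of keys it is the Erdos-Szekeres dichotomy.\<close>

lemma increasing_chain_or_independent:
  fixes R :: "nat \<Rightarrow> nat \<Rightarrow> bool"
  assumes "k * l \<le> m" "0 < l"
  shows "(\<exists>f. (\<forall>i j. i < j \<longrightarrow> j < k \<longrightarrow> f i < f j) \<and> (\<forall>i<k. f i < m) \<and>
      (\<forall>i. Suc i < k \<longrightarrow> R (f i) (f (Suc i)))) \<or>
    (\<exists>D\<subseteq>{..<m}. l \<le> card D \<and> (\<forall>i\<in>D. \<forall>j\<in>D. i < j \<longrightarrow> \<not> R i j))"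
proof -
  let ?Q = "\<lambda>i j. i < j \<and> R i j"
  have "k * l \<le> card {..<m}" using assms by simp
  from chain_or_independent[OF finite_lessThan this assms(2), of ?Q] show ?thesis
  proof
    assume "\<exists>xs. length xs = k \<and> set xs \<subseteq> {..<m} \<and> successively ?Q xs"
    then obtain xs where xs: "length xs = k" "set xs \<subseteq> {..<m}" "successively ?Q xs" by blast
    have "successively (<) xs" using xs(3) by (rule successively_mono) auto
    then have "sorted_wrt (<) xs" by (simp add: successively_conv_sorted_wrt)
    then show ?thesis using xs
      by (intro disjI1 exI[of _ "nth xs"])
        (auto simp: sorted_wrt_iff_nth_less successively_conv_nth subset_iff)
  next
    assume "\<exists>D\<subseteq>{..<m}. l \<le> card D \<and> (\<forall>i\<in>D. \<forall>j\<in>D. \<not> ?Q i j)"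
    then show ?thesis by blast
  qed
qed

lemma finite_nat_set_enumeration:
  fixes D :: "nat set"
  assumes "finite D" "k \<le> card D"
  obtains f where "\<And>i j. i < j \<Longrightarrow> j < k \<Longrightarrow> f i < f j" "\<And>i. i < k \<Longrightarrow> f i \<in> D"
proof
  let ?xs = "sorted_list_of_set D"
  show "?xs ! i < ?xs ! j" if "i < j" "j < k" for i j
    using that assms strict_sorted_list_of_set[of D] by (auto simp: sorted_wrt_iff_nth_less)
  show "?xs ! i \<in> D" if "i < k" for i
    using that assms nth_mem[of i ?xs] by simp
qed

section \<open>Ladders on arbitrary points in general position\<close>

lemma cross2_diff_right: "cross2 d (u - v) = cross2 d u - cross2 d v"
  by (simp add: cross2_def algebra_simps)

text \<open>The cotangent of the angle from \<open>d\<close> to \<open>v\<close>, which sorts the open half-plane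
  \<open>cross2 d v > 0\<close> clockwise.\<close>
definition angle_key :: "point \<Rightarrow> point \<Rightarrow> real" where
  "angle_key d v = (fst d * fst v + snd d * snd v) / cross2 d v"

text \<open>The difference formula for cotangents: the squared length of \<open>d\<close> times
  \<open>cross2 u v\<close> equals \<open>cross2 d u * cross2 d v\<close> times the difference of
  the keys.\<close>

lemma cross2_pos_iff_angle_key:
  assumes "cross2 d u > 0" "cross2 d v > 0"
  shows "cross2 u v > 0 \<longleftrightarrow> angle_key d v < angle_key d u"
proof -
  let ?D = "(fst d)\<^sup>2 + (snd d)\<^sup>2"
  have "d \<noteq> 0" using assms by (auto simp: cross2_def)
  then have "?D > 0" by (simp add: sum_power2_gt_zero_iff prod_eq_iff)
  moreover have "?D * cross2 u v = cross2 d u * cross2 d v * (angle_key d u - angle_key d v)"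
  proof -
    have "cross2 d u * cross2 d v * (angle_key d u - angle_key d v) =
      (fst d * fst u + snd d * snd u) * cross2 d v - (fst d * fst v + snd d * snd v) * cross2 d u"
      using assms by (simp add: angle_key_def field_simps)
    then show ?thesis by (simp add: cross2_def power2_eq_square algebra_simps)
  qed
  ultimately show ?thesis using assms
    by (metis diff_gt_0_iff_gt mult_pos_pos zero_less_mult_pos)
qed

lemma cross2_neg_iff_angle_key:
  assumes "cross2 d u > 0" "cross2 d v > 0"
  shows "cross2 u v < 0 \<longleftrightarrow> angle_key d u < angle_key d v"
proof -
  have "cross2 u v = - cross2 v u" by (simp add: cross2_def)
  then show ?thesis using cross2_pos_iff_angle_key[OF assms(2,1)] by simp
qed

text \<open>\<open>Z\<close> lies in an open half-plane bounded by a line through \<open>t\<close>,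
  so \<open>angle_key\<close> orders it linearly around \<open>t\<close>; the two extremes give the
  tangents from \<open>t\<close> to \<open>Z\<close>.\<close>

lemma extreme_direction:
  assumes "finite Z" "Z \<noteq> {}" "\<And>z. z \<in> Z \<Longrightarrow> cross2 d (z - t) > 0"
  shows "\<exists>r\<in>Z. \<forall>z\<in>Z. orient t r z \<le> 0" "\<exists>r\<in>Z. \<forall>z\<in>Z. orient t r z \<ge> 0"
proof -
  let ?k = "\<lambda>z. angle_key d (z - t)"
  have fin: "finite (?k ` Z)" "?k ` Z \<noteq> {}" using assms by auto
  obtain r where r: "r \<in> Z" "?k r = Min (?k ` Z)" using Min_in[OF fin] by auto
  have "orient t r z \<le> 0" if "z \<in> Z" for z
  proof -
    have "?k r \<le> ?k z" using r fin that by simp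
    then show ?thesis
      using cross2_pos_iff_angle_key[OF assms(3)[OF r(1)] assms(3)[OF that]] by (simp add: orient_def not_less[symmetric])
  qed
  then show "\<exists>r\<in>Z. \<forall>z\<in>Z. orient t r z \<le> 0" using r by blast
  obtain r where r: "r \<in> Z" "?k r = Max (?k ` Z)" using Max_in[OF fin] by auto
  have "orient t r z \<ge> 0" if "z \<in> Z" for z
  proof -
    have "?k z \<le> ?k r" using r fin that by simp
    then show ?thesis
      using cross2_neg_iff_angle_key[OF assms(3)[OF r(1)] assms(3)[OF that]] by (simp add: orient_def not_less[symmetric])
  qed
  then show "\<exists>r\<in>Z. \<forall>z\<in>Z. orient t r z \<ge> 0" using r by blast
qed

text \<open>\<open>cross2 (1, t)\<close> identifies two distinct points only if their line has slope
  \<open>t\<close>, and finitely many slopes can be avoided. Pairs with equal first coordinate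
  contribute the quotient 0, which merely excludes one more value.\<close>

lemma injective_direction:
  assumes "finite (Q :: point set)"
  obtains d where "inj_on (cross2 d) Q"
proof -
  let ?B = "(\<lambda>(z, w). (snd z - snd w) / (fst z - fst w)) ` (Q \<times> Q)"
  have "finite ?B" using assms by simp
  then obtain t :: real where t: "t \<notin> ?B" using ex_new_if_finite infinite_UNIV_char_0 by blast
  have "inj_on (cross2 (1, t)) Q"
  proof (rule inj_onI)
    fix z w assume zw: "z \<in> Q" "w \<in> Q" and "cross2 (1, t) z = cross2 (1, t) w"
    then have eq: "snd z - snd w = t * (fst z - fst w)" by (simp add: cross2_def algebra_simps)
    have "fst z = fst w"
    proof (rule ccontr)
      assume "fst z \<noteq> fst w"
      then have "t = (snd z - snd w) / (fst z - fst w)" using eq by simp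
      then show False using t zw by (force intro!: image_eqI[of _ _ "(z, w)"])
    qed
    then show "z = w" using eq by (simp add: prod_eq_iff)
  qed
  then show thesis by (rule that)
qed

section \<open>Building a ladder by peeling off hull edges\<close>

lemma general_position_subset: "general_position P \<Longrightarrow> Q \<subseteq> P \<Longrightarrow> general_position Q"
  unfolding general_position_def by blast

text \<open>The line \<open>a b\<close> has \<open>x y\<close> weakly on one side and
  \<open>p\<close> strictly on the other, so the segments can meet only on the line, which
  \<open>p r\<close> reaches only in \<open>r\<close>.\<close>

lemma supported_segments_meet:
  assumes "orient a b x \<le> 0 \<and> orient a b y \<le> 0 \<and> orient a b p > 0
      \<or> orient a b x \<ge> 0 \<and> orient a b y \<ge> 0 \<and> orient a b p < 0"
    and "orient a b r = 0"
  shows "closed_segment p r \<inter> closed_segment x y \<subseteq> {r}"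
proof
  fix z assume z: "z \<in> closed_segment p r \<inter> closed_segment x y"
  then obtain u where u: "0 \<le> u" "u \<le> 1" "z = (1 - u) *\<^sub>R p + u *\<^sub>R r" by (auto simp: in_segment)
  obtain v where v: "0 \<le> v" "v \<le> 1" "z = (1 - v) *\<^sub>R x + v *\<^sub>R y" using z by (auto simp: in_segment)
  have 1: "orient a b z = (1 - u) * orient a b p" using u assms(2) by (simp add: orient_affine)
  have 2: "orient a b z = (1 - v) * orient a b x + v * orient a b y" using v by (simp add: orient_affine)
  have "orient a b z = 0"
    using assms(1)
  proof
    assume h: "orient a b x \<le> 0 \<and> orient a b y \<le> 0 \<and> orient a b p > 0"
    then have "orient a b z \<le> 0" unfolding 2 using v by (intro add_nonpos_nonpos mult_nonneg_nonpos) auto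
    moreover have "orient a b z \<ge> 0" unfolding 1 using u h by simp
    ultimately show ?thesis by simp
  next
    assume h: "orient a b x \<ge> 0 \<and> orient a b y \<ge> 0 \<and> orient a b p < 0"
    then have "orient a b z \<ge> 0" unfolding 2 using v by (intro add_nonneg_nonneg mult_nonneg_nonneg) auto
    moreover have "orient a b z \<le> 0" unfolding 1 using u h by (intro mult_nonneg_nonpos) auto
    ultimately show ?thesis by simp
  qed
  then show "z \<in> {r}" using orient_segment_end[of z p r a b] z assms by auto
qed

text \<open>The induction needs a prescribed first rung \<open>p q\<close> with all of
  \<open>Q\<close> on one side. Each step spends two points of \<open>Q\<close> on the next rung,
  again with the remaining points on one side.\<close>

lemma ladder_drawing_below_edge:
  assumes "finite Q" "general_position (insert p (insert q Q))" "p \<noteq> q"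
    "\<And>z. z \<in> Q \<Longrightarrow> orient p q z > 0" "2 * n \<le> card Q"
  shows "\<exists>c. ladder_drawing (Suc n) c \<and> c False 0 = p \<and> c True 0 = q \<and>
    (\<forall>s i. 0 < i \<longrightarrow> i \<le> n \<longrightarrow> c s i \<in> Q)"
  using assms
proof (induction n arbitrary: p q Q)
  case 0
  have "ladder_drawing (Suc 0) (\<lambda>s i. if s then q else p)"
    using 0 by (auto simp: ladder_drawing_def inj_on_def)
  then show ?case by (intro exI[of _ "\<lambda>s i. if s then q else p"]) auto
next
  case (Suc n)
  note gp = orient_nonzero_if_general_position[OF Suc.prems(2)]
  note pos = Suc.prems(4)
  have pq: "p \<notin> Q" "q \<notin> Q" using pos by fastforce+
  have "Q \<noteq> {}" using Suc.prems by auto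
  then obtain t where t: "t \<in> Q" "\<forall>z\<in>Q. orient p t z \<ge> 0"
    using extreme_direction(2)[of Q "q - p" p] Suc.prems by (auto simp: orient_def)
  have t': "orient p t z > 0" if "z \<in> Q - {t}" for z
    using t that gp[of p t z] pq by (metis DiffD1 DiffD2 insertCI insertI1 order_le_less)
  \<comment> \<open>\<open>t\<close> is the first point of \<open>Q\<close> met when turning from \<open>q\<close> around \<open>p\<close>, and \<open>r\<close> the last one
    around \<open>t\<close>.  So \<open>t r\<close> is an edge of the convex hull of \<open>Q\<close>, and \<open>q t\<close> and \<open>p r\<close> meet that hull
    in one point only: take \<open>r t\<close> as the next rung.\<close>
  have "card (Q - {t}) \<ge> 1" using Suc.prems t by simp
  then have "Q - {t} \<noteq> {}" by force
  moreover have "cross2 (t - p) (z - t) > 0" if "z \<in> Q - {t}" for z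
    using t'[OF that] by (simp add: orient_def cross2_def algebra_simps)
  ultimately obtain r where r: "r \<in> Q - {t}" "\<forall>z\<in>Q - {t}. orient t r z \<le> 0"
    using extreme_direction(1)[of "Q - {t}" "t - p" t] Suc.prems(1) by auto
  let ?Q = "Q - {r, t}"
  have rt: "orient r t z > 0" if "z \<in> ?Q" for z
  proof -
    have "orient t r z \<le> 0" using r that by auto
    moreover have "orient t r z \<noteq> 0" using that r t by (intro gp) auto
    moreover have "orient r t z = - orient t r z" by (simp add: orient_def cross2_def algebra_simps)
    ultimately show ?thesis by simp
  qed
  have "card ?Q = card Q - 2" using r t Suc.prems(1) by (simp add: card_Diff_subset)
  then have card: "2 * n \<le> card ?Q" using Suc.prems by simp
  have gp': "general_position (insert r (insert t ?Q))"
    by (rule general_position_subset[OF Suc.prems(2)]) (use r t in auto)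
  obtain c where c: "ladder_drawing (Suc n) c" "c False 0 = r" "c True 0 = t"
      "\<And>s i. 0 < i \<Longrightarrow> i \<le> n \<Longrightarrow> c s i \<in> ?Q"
    using Suc.IH[OF _ gp' _ rt card] Suc.prems(1) r by auto
  have cQ: "c s i \<in> Q" if "i \<le> n" for s i
    using c(2,3) c(4)[of i s] r t that by (cases "i = 0"; cases s) auto
  note D = c(1)[unfolded ladder_drawing_def]
  have inj: "c s i = c s' j \<longleftrightarrow> s = s' \<and> i = j" if "i \<le> n" "j \<le> n" for s s' i j
    using inj_on_eq_iff[OF D[THEN conjunct1], of "(s, i)" "(s', j)"] that by simp
  have D1: "closed_segment (c s i) (c s (Suc i)) \<inter> closed_segment (c s j) (c s (Suc j))
      \<subseteq> {c s (Suc i)} \<inter> {c s j}" if "i < j" "Suc j < Suc n" for s i j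
    using D[THEN conjunct2, THEN conjunct1] that by blast
  have D2: "closed_segment (c False i) (c False (Suc i)) \<inter> closed_segment (c True j) (c True (Suc j)) = {}"
    if "Suc i < Suc n" "Suc j < Suc n" for i j
    using D[THEN conjunct2, THEN conjunct2, THEN conjunct1] that by blast
  have D3: "closed_segment (c s i) (c s (Suc i)) \<inter> closed_segment (c False j) (c True j)
      \<subseteq> {c s i, c s (Suc i)} \<inter> {c s j}" if "Suc i < Suc n" "j < Suc n" for s i j
    using D[THEN conjunct2, THEN conjunct2, THEN conjunct2, THEN conjunct1] that by blast
  have D4: "closed_segment (c False i) (c True i) \<inter> closed_segment (c False j) (c True j) = {}"
    if "i < j" "j < Suc n" for i j
    using D[THEN conjunct2, THEN conjunct2, THEN conjunct2, THEN conjunct2] that by blast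
  define e where "e = (\<lambda>s. if s then q else p)"
  have E0: "closed_segment p q \<inter> closed_segment x y = {}" if "x \<in> Q" "y \<in> Q" for x y
    using that pos by (intro segments_disjoint_same_side) auto
  \<comment> \<open>The lines \<open>p t\<close> and \<open>t r\<close> support \<open>Q\<close>, so
    the two new side edges meet segments inside \<open>Q\<close> only in \<open>t\<close> and
    \<open>r\<close>.\<close>
  have E1: "closed_segment (e s) (c s 0) \<inter> closed_segment x y \<subseteq> {c s 0}" if "x \<in> Q" "y \<in> Q" for x y s
  proof (cases s)
    case True
    have "orient p t q < 0" using pos[OF t(1)] by (simp add: orient_swap[of p t])
    then have "closed_segment q t \<inter> closed_segment x y \<subseteq> {t}"
      using that t by (intro supported_segments_meet[of p t]) auto
    then show ?thesis using True c by (simp add: e_def)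
  next
    case False
    have "orient t r p > 0" using t'[OF r(1)] orient_rotate[of p t r] by simp
    moreover have "orient t r z \<le> 0" if "z \<in> Q" for z using r that by (cases "z = t") auto
    ultimately have "closed_segment p r \<inter> closed_segment x y \<subseteq> {r}"
      using that by (intro supported_segments_meet[of t r]) auto
    then show ?thesis using False c by (simp add: e_def)
  qed
  \<comment> \<open>The line \<open>p t\<close> separates \<open>q\<close> from \<open>r\<close>, so
    a common point would have to equal both \<open>p\<close> and \<open>t\<close>.\<close>
  have E2: "closed_segment p r \<inter> closed_segment q t = {}"
  proof -
    have h: "orient p t q < 0" "orient p t r > 0"
      using pos[OF t(1)] t'[OF r(1)] by (simp_all add: orient_swap[of p t])
    have "closed_segment r p \<inter> closed_segment q t \<subseteq> {p}"
      using h by (intro supported_segments_meet[of p t]) auto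
    moreover have "closed_segment q t \<inter> closed_segment r p \<subseteq> {t}"
      using h by (intro supported_segments_meet[of p t]) auto
    moreover have "p \<noteq> t" using t pq by auto
    ultimately show ?thesis by (auto simp: closed_segment_commute)
  qed
  have E3: "closed_segment (e s) (c s 0) \<inter> closed_segment p q \<subseteq> {e s}" for s
  proof (cases s)
    case True
    have "orient q p t \<noteq> 0" using pq t Suc.prems(3) by (intro gp) auto
    from segments_meet_at_common_end[OF this] show ?thesis
      using True c by (auto simp: e_def closed_segment_commute)
  next
    case False
    have "orient p q r \<noteq> 0" using pq r Suc.prems(3) by (intro gp) auto
    from segments_meet_at_common_end[OF this] show ?thesis
      using False c by (auto simp: e_def closed_segment_commute)
  qed
  \<comment> \<open>By \<open>E1\<close>, a new side edge can meet an old edge only in a vertex of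
    the old first rung; \<open>N1\<close> and \<open>N2\<close> show that this happens only for old
    edges incident to that vertex.\<close>
  have N1: "c s0 0 \<in> closed_segment (c s j) (c s (Suc j)) \<Longrightarrow> s0 = s \<and> j = 0"
    if "Suc j < Suc n" for s0 s j
  proof -
    assume z: "c s0 0 \<in> closed_segment (c s j) (c s (Suc j))"
    have "c s0 0 \<in> closed_segment (c False 0) (c True 0)" by (cases s0) auto
    then have "c s0 0 \<in> {c s j, c s (Suc j)} \<inter> {c s 0}" using D3[of j 0 s] z that by blast
    then show ?thesis using inj[of 0 0 s0 s] inj[of 0 j s s] inj[of 0 "Suc j" s s] that by auto
  qed
  have N2: "c s0 0 \<in> closed_segment (c False j) (c True j) \<Longrightarrow> j = 0" if "j < Suc n" for s0 j
  proof (rule ccontr)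
    assume z: "c s0 0 \<in> closed_segment (c False j) (c True j)" and "j \<noteq> 0"
    have "c s0 0 \<in> closed_segment (c False 0) (c True 0)" by (cases s0) auto
    then show False using D4[of 0 j] z that \<open>j \<noteq> 0\<close> by blast
  qed
  \<comment> \<open>The old drawing is shifted by one index and the rung \<open>p q\<close> is put
    in front.\<close>
  define c' where "c' = (\<lambda>s i. case i of 0 \<Rightarrow> e s | Suc i \<Rightarrow> c s i)"
  have c'0 [simp]: "c' s 0 = e s" for s by (simp add: c'_def)
  have c'S [simp]: "c' s (Suc i) = c s i" for s i by (simp add: c'_def)
  have eFT: "e False = p" "e True = q" by (simp_all add: e_def)
  have eQ: "e s \<notin> Q" for s using pq by (simp add: e_def)
  have "ladder_drawing (Suc (Suc n)) c'"
    unfolding ladder_drawing_def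
  proof (intro conjI allI impI; (elim conjE)?)
    show "inj_on (\<lambda>(s, i). c' s i) (UNIV \<times> {..<Suc (Suc n)})"
    proof (rule inj_onI, clarsimp)
      fix s i s' j assume ij: "i < Suc (Suc n)" "j < Suc (Suc n)" and eq: "c' s i = c' s' j"
      have ee: "e s = e s' \<longleftrightarrow> s = s'" using Suc.prems(3) by (auto simp: e_def)
      show "s = s' \<and> i = j"
        using ij eq ee inj[of "i - 1" "j - 1" s s'] cQ[of "i - 1" s] cQ[of "j - 1" s'] eQ[of s] eQ[of s']
        by (cases i; cases j) auto
    qed
  next
    fix s i j assume ij: "i < j" "Suc j < Suc (Suc n)"
    then obtain j' where j: "j = Suc j'" by (cases j) auto
    show "closed_segment (c' s i) (c' s (Suc i)) \<inter> closed_segment (c' s j) (c' s (Suc j))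
        \<subseteq> {c' s (Suc i)} \<inter> {c' s j}"
    proof (cases i)
      case 0
      have "closed_segment (e s) (c s 0) \<inter> closed_segment (c s j') (c s (Suc j')) \<subseteq> {c s 0}"
        using ij j by (intro E1 cQ) auto
      moreover have "j' = 0" if "c s 0 \<in> closed_segment (c s j') (c s (Suc j'))"
        using N1[OF _ that] ij j by simp
      ultimately show ?thesis using 0 j by auto
    next
      case (Suc i')
      then show ?thesis using D1[of i' j' s] ij j by simp
    qed
  next
    fix i j assume ij: "Suc i < Suc (Suc n)" "Suc j < Suc (Suc n)"
    have F: "closed_segment (e s) (c s 0) \<inter> closed_segment (c (\<not> s) k) (c (\<not> s) (Suc k)) = {}"
      if "Suc k < Suc n" for s k
      using E1[of "c (\<not> s) k" "c (\<not> s) (Suc k)" s] N1[OF that, of s "\<not> s"] cQ that by auto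
    show "closed_segment (c' False i) (c' False (Suc i)) \<inter> closed_segment (c' True j) (c' True (Suc j)) = {}"
    proof (cases i; cases j)
      assume "i = 0" "j = 0"
      then show ?thesis using E2 c by (simp add: eFT)
    next
      fix j' assume "i = 0" "j = Suc j'"
      then show ?thesis using F[of j' False] ij by simp
    next
      fix i' assume "i = Suc i'" "j = 0"
      then show ?thesis using F[of i' True] ij by (simp add: Int_commute)
    next
      fix i' j' assume "i = Suc i'" "j = Suc j'"
      then show ?thesis using D2[of i' j'] ij by simp
    qed
  next
    fix s i j assume ij: "Suc i < Suc (Suc n)" "j < Suc (Suc n)"
    show "closed_segment (c' s i) (c' s (Suc i)) \<inter> closed_segment (c' False j) (c' True j)
        \<subseteq> {c' s i, c' s (Suc i)} \<inter> {c' s j}"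
    proof (cases i; cases j)
      assume "i = 0" "j = 0"
      then show ?thesis using E3[of s] by (auto simp: eFT)
    next
      fix j' assume i: "i = 0" and j: "j = Suc j'"
      have "closed_segment (e s) (c s 0) \<inter> closed_segment (c False j') (c True j') \<subseteq> {c s 0}"
        using ij j by (intro E1 cQ) auto
      moreover have "j' = 0" if "c s 0 \<in> closed_segment (c False j') (c True j')"
        using N2[OF _ that] ij j by simp
      ultimately show ?thesis using i j by auto
    next
      fix i' assume "i = Suc i'" "j = 0"
      then show ?thesis using E0[of "c s i'" "c s (Suc i')"] cQ ij by (auto simp: eFT)
    next
      fix i' j' assume "i = Suc i'" "j = Suc j'"
      then show ?thesis using D3[of i' j' s] ij by simp
    qed
  next
    fix i j assume ij: "i < j" "j < Suc (Suc n)"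
    then obtain j' where j: "j = Suc j'" by (cases j) auto
    show "closed_segment (c' False i) (c' True i) \<inter> closed_segment (c' False j) (c' True j) = {}"
    proof (cases i)
      case 0
      then show ?thesis using E0[of "c False j'" "c True j'"] cQ ij j by (simp add: eFT)
    next
      case (Suc i')
      then show ?thesis using D4[of i' j'] ij j by simp
    qed
  qed
  moreover have "c' s i \<in> Q" if "0 < i" "i \<le> Suc n" for s i
    using that cQ by (cases i) auto
  ultimately show ?case by (intro exI[of _ c']) (auto simp: eFT)
qed

text \<open>\<open>p\<close> is minimal in a generic direction and \<open>q\<close> is extreme as
  seen from \<open>p\<close>, so \<open>p q\<close> is a hull edge and serves as first rung; two
  points each remain for the other \<open>n - 1\<close> rungs.\<close>

lemma ladder_drawing_in_general_position:
  assumes "finite Q" "general_position Q" "2 * n \<le> card Q" "0 < n"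
  shows "\<exists>c. ladder_drawing n c \<and> (\<forall>s i. i < n \<longrightarrow> c s i \<in> Q)"
proof -
  obtain d where d: "inj_on (cross2 d) Q" using injective_direction[OF assms(1)] .
  have fin: "finite (cross2 d ` Q)" "cross2 d ` Q \<noteq> {}" using assms by auto
  obtain p where p: "p \<in> Q" "cross2 d p = Min (cross2 d ` Q)" using Min_in[OF fin] by auto
  have "cross2 d (z - p) > 0" if "z \<in> Q - {p}" for z
  proof -
    have "cross2 d p \<le> cross2 d z" using p fin that by simp
    moreover have "cross2 d p \<noteq> cross2 d z" using d p that by (auto simp: inj_on_eq_iff)
    ultimately show ?thesis by (simp add: cross2_diff_right)
  qed
  moreover have "card (Q - {p}) \<ge> 1" using assms p by simp
  then have "Q - {p} \<noteq> {}" by force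
  ultimately obtain q where q: "q \<in> Q - {p}" "\<forall>z\<in>Q - {p}. orient p q z \<ge> 0"
    using extreme_direction(2)[of "Q - {p}" d p] assms(1) by auto
  let ?Q = "Q - {p, q}"
  have pos: "orient p q z > 0" if "z \<in> ?Q" for z
    using q that orient_nonzero_if_general_position[OF assms(2), of p q z] p
    by (metis DiffD1 DiffD2 DiffI insertCI order_le_less singletonD)
  have "card {p, q} = 2" using q by auto
  then have "card ?Q = card Q - 2" using p q assms(1) by (simp add: card_Diff_subset)
  then have "2 * (n - 1) \<le> card ?Q" using assms by simp
  moreover have "general_position (insert p (insert q ?Q))"
    by (rule general_position_subset[OF assms(2)]) (use p q in auto)
  ultimately obtain c where c: "ladder_drawing (Suc (n - 1)) c" "c False 0 = p" "c True 0 = q"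
      "\<And>s i. 0 < i \<Longrightarrow> i \<le> n - 1 \<Longrightarrow> c s i \<in> ?Q"
    using ladder_drawing_below_edge[of ?Q p q "n - 1"] pos assms(1) q by auto
  have "c s i \<in> Q" if "i < n" for s i
    using c(2,3) c(4)[of i s] p q that by (cases "i = 0"; cases s) auto
  then show ?thesis using c(1) assms(4) by auto
qed

section \<open>Mutually avoiding subsets\<close>

text \<open>The \<open>r\<close>-th smallest value of \<open>h\<close> on \<open>X\<close>, counted
  with multiplicity. The min-max form makes continuity in a parameter immediate.\<close>

definition order_stat :: "nat \<Rightarrow> ('a \<Rightarrow> real) \<Rightarrow> 'a set \<Rightarrow> real" where
  "order_stat r h X = Min ((\<lambda>U. Max (h ` U)) ` {U. U \<subseteq> X \<and> card U = r})"

lemma order_stat_rank: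
  assumes "finite X" "0 < r" "r \<le> card X"
  shows "order_stat r h X \<in> h ` X" "r \<le> card {x \<in> X. h x \<le> order_stat r h X}"
    "card {x \<in> X. h x < order_stat r h X} < r"
proof -
  let ?F = "{U. U \<subseteq> X \<and> card U = r}"
  have fin: "finite ((\<lambda>U. Max (h ` U)) ` ?F)" using assms(1) by simp
  have "?F \<noteq> {}" using obtain_subset_with_card_n[OF assms(3)] by blast
  then obtain U where U: "U \<subseteq> X" "card U = r" "order_stat r h X = Max (h ` U)"
    using Min_in[OF fin] unfolding order_stat_def by auto
  have finU: "finite U" "U \<noteq> {}" using U assms finite_subset by auto
  have "Max (h ` U) \<in> h ` U" using finU by simp
  then show "order_stat r h X \<in> h ` X" using U by auto
  have "U \<subseteq> {x \<in> X. h x \<le> order_stat r h X}" using U finU by auto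
  then have "card U \<le> card {x \<in> X. h x \<le> order_stat r h X}" using assms(1) by (intro card_mono) auto
  then show "r \<le> card {x \<in> X. h x \<le> order_stat r h X}" using U by simp
  show "card {x \<in> X. h x < order_stat r h X} < r"
  proof (rule ccontr)
    assume "\<not> card {x \<in> X. h x < order_stat r h X} < r"
    then obtain W where W: "W \<subseteq> {x \<in> X. h x < order_stat r h X}" "card W = r"
      using obtain_subset_with_card_n[of r "{x \<in> X. h x < order_stat r h X}"] by (auto simp: not_less)
    then have finW: "finite W" "W \<noteq> {}" using assms by (auto intro: card_ge_0_finite)
    then have "Max (h ` W) < order_stat r h X" using W by auto
    moreover have "order_stat r h X \<le> Max (h ` W)"
      unfolding order_stat_def using fin W by (intro Min_le) auto
    ultimately show False by simp
  qed
qed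

lemma order_stat_halves:
  assumes "finite X" "0 < r" "2 * r \<le> card X"
  shows "r \<le> card {x \<in> X. h x \<le> order_stat r h X}" "r \<le> card {x \<in> X. order_stat r h X \<le> h x}"
proof -
  let ?c = "order_stat r h X"
  have r: "r \<le> card X" using assms by simp
  show "r \<le> card {x \<in> X. h x \<le> ?c}" by (rule order_stat_rank(2)[OF assms(1,2) r])
  have "{x \<in> X. ?c \<le> h x} = X - {x \<in> X. h x < ?c}" by auto
  then have "card {x \<in> X. ?c \<le> h x} = card X - card {x \<in> X. h x < ?c}"
    using assms(1) by (simp add: card_Diff_subset)
  then show "r \<le> card {x \<in> X. ?c \<le> h x}" using order_stat_rank(3)[OF assms(1,2) r, of h] assms(3) by linarith
qed

section \<open>Continuity of order statistics and a discrete ham-sandwich cut\<close>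

lemma continuous_on_Max_finite:
  fixes g :: "'b::topological_space \<Rightarrow> 'a \<Rightarrow> real"
  assumes "finite U" "U \<noteq> {}" "\<And>u. u \<in> U \<Longrightarrow> continuous_on S (\<lambda>s. g s u)"
  shows "continuous_on S (\<lambda>s. Max (g s ` U))"
  using assms
proof (induction rule: finite_ne_induct)
  case (insert x F)
  have "Max (g s ` insert x F) = max (g s x) (Max (g s ` F))" for s using insert by simp
  then show ?case using insert by (simp add: continuous_on_max)
qed simp

lemma continuous_on_Min_finite:
  fixes g :: "'b::topological_space \<Rightarrow> 'a \<Rightarrow> real"
  assumes "finite U" "U \<noteq> {}" "\<And>u. u \<in> U \<Longrightarrow> continuous_on S (\<lambda>s. g s u)"
  shows "continuous_on S (\<lambda>s. Min (g s ` U))"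
  using assms
proof (induction rule: finite_ne_induct)
  case (insert x F)
  have "Min (g s ` insert x F) = min (g s x) (Min (g s ` F))" for s using insert by simp
  then show ?case using insert by (simp add: continuous_on_min)
qed simp

lemma continuous_on_order_stat:
  fixes g :: "'b::topological_space \<Rightarrow> 'a \<Rightarrow> real"
  assumes "finite X" "0 < r" "r \<le> card X" "\<And>x. x \<in> X \<Longrightarrow> continuous_on S (\<lambda>s. g s x)"
  shows "continuous_on S (\<lambda>s. order_stat r (g s) X)"
  unfolding order_stat_def
proof (rule continuous_on_Min_finite)
  show "finite {U. U \<subseteq> X \<and> card U = r}" using assms(1) by simp
  show "{U. U \<subseteq> X \<and> card U = r} \<noteq> {}" using obtain_subset_with_card_n[OF assms(3)] by blast
  fix U assume U: "U \<in> {U. U \<subseteq> X \<and> card U = r}"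
  then show "continuous_on S (\<lambda>s. Max (g s ` U))"
    using assms finite_subset by (intro continuous_on_Max_finite) auto
qed

text \<open>Here \<open>s\<close> is the slope of the cutting line.  As \<open>xi\<close> separates \<open>X\<close> from \<open>Y\<close>, the sign of the
  difference of the order statistics changes as \<open>s\<close> runs from very small to very large.\<close>
lemma ham_sandwich_separated:
  fixes xi eta :: "'a \<Rightarrow> real"
  assumes fin: "finite X" "finite Y" and r: "0 < r" "r \<le> card X" "r \<le> card Y"
    and sep: "\<And>x y. x \<in> X \<Longrightarrow> y \<in> Y \<Longrightarrow> xi x < xi y"
  shows "\<exists>s. order_stat r (\<lambda>p. eta p - s * xi p) X = order_stat r (\<lambda>p. eta p - s * xi p) Y"
proof -
  let ?g = "\<lambda>s p. eta p - s * xi p"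
  let ?f = "\<lambda>s. order_stat r (?g s) X - order_stat r (?g s) Y"
  \<comment> \<open>The slopes of all lines joining \<open>X\<close> to \<open>Y\<close>. At the
    largest slope every value of \<open>?g\<close> on \<open>X\<close> is at least every value on
    \<open>Y\<close>, at the smallest slope at most, so the intermediate value theorem applies
    between them.\<close>
  let ?T = "(\<lambda>(x, y). (eta y - eta x) / (xi y - xi x)) ` (X \<times> Y)"
  have ne: "X \<noteq> {}" "Y \<noteq> {}" using r by auto
  then have T: "finite ?T" "?T \<noteq> {}" using fin by auto
  have cont: "continuous_on A ?f" for A
    using fin r by (intro continuous_intros continuous_on_order_stat)
  have in_img: "order_stat r (?g s) X \<in> ?g s ` X" "order_stat r (?g s) Y \<in> ?g s ` Y" for s
    using order_stat_rank(1) fin r by blast+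
  have hi: "?f (Max ?T) \<ge> 0"
  proof -
    obtain x y where xy: "x \<in> X" "y \<in> Y" "order_stat r (?g (Max ?T)) X = ?g (Max ?T) x"
        "order_stat r (?g (Max ?T)) Y = ?g (Max ?T) y"
      using in_img[of "Max ?T"] by auto
    have "(eta y - eta x) / (xi y - xi x) \<le> Max ?T" using T xy by (intro Max_ge) auto
    then have "eta y - eta x \<le> Max ?T * (xi y - xi x)" using sep[OF xy(1,2)] by (simp add: pos_divide_le_eq)
    then show ?thesis using xy by (simp add: algebra_simps)
  qed
  have lo: "?f (Min ?T) \<le> 0"
  proof -
    obtain x y where xy: "x \<in> X" "y \<in> Y" "order_stat r (?g (Min ?T)) X = ?g (Min ?T) x"
        "order_stat r (?g (Min ?T)) Y = ?g (Min ?T) y"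
      using in_img[of "Min ?T"] by auto
    have "(eta y - eta x) / (xi y - xi x) \<ge> Min ?T" using T xy by (intro Min_le) auto
    then have "eta y - eta x \<ge> Min ?T * (xi y - xi x)" using sep[OF xy(1,2)] by (simp add: pos_le_divide_eq)
    then show ?thesis using xy by (simp add: algebra_simps)
  qed
  have "Min ?T \<le> Max ?T" using T by (meson Max_ge Min_in)
  then obtain s where "?f s = 0" using IVT'[of ?f "Min ?T" 0 "Max ?T", OF lo hi _ cont] by blast
  then show ?thesis by (intro exI[of _ s]) simp
qed

text \<open>The upper halves of \<open>X\<close> and \<open>Y\<close> above the common median \<open>c\<close> are halved again, at \<open>d X\<close> and
  \<open>d Y\<close>; the set with the smaller value of \<open>d\<close> provides \<open>A\<close>.\<close>
lemma separated_triple: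
  fixes xi eta :: "'a \<Rightarrow> real"
  assumes fin: "finite X" "finite Y" and q: "0 < q" "4 * q \<le> card X" "4 * q \<le> card Y"
    and sep: "\<And>x y. x \<in> X \<Longrightarrow> y \<in> Y \<Longrightarrow> xi x < xi y"
  shows "\<exists>s A B1 B2. (A \<subseteq> X \<and> B1 \<subseteq> Y \<and> B2 \<subseteq> Y \<or> A \<subseteq> Y \<and> B1 \<subseteq> X \<and> B2 \<subseteq> X) \<and>
    q \<le> card A \<and> q \<le> card B1 \<and> q \<le> card B2 \<and>
    (\<forall>a\<in>A. \<forall>b\<in>B1. eta b - s * xi b \<le> eta a - s * xi a) \<and>
    (\<forall>a\<in>A. \<forall>b\<in>B2. eta a - s * xi a \<le> eta b - s * xi b)"
proof -
  obtain s where s: "order_stat (2 * q) (\<lambda>p. eta p - s * xi p) X = order_stat (2 * q) (\<lambda>p. eta p - s * xi p) Y"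
    using ham_sandwich_separated[of X Y "2 * q" xi eta] assms by auto
  define g where "g = (\<lambda>p. eta p - s * xi p)"
  define c where "c = order_stat (2 * q) g X"
  have c: "c = order_stat (2 * q) g Y" using s by (simp add: c_def g_def)
  have halves: "2 * q \<le> card {x \<in> Z. g x \<le> c}" "2 * q \<le> card {x \<in> Z. c \<le> g x}" if "Z = X \<or> Z = Y" for Z
    using order_stat_halves[of X "2 * q" g] order_stat_halves[of Y "2 * q" g] that fin q
    unfolding c_def[symmetric] c[symmetric] by auto
  define d where "d = (\<lambda>Z. order_stat q g {x \<in> Z. c \<le> g x})"
  have quarters: "q \<le> card {x \<in> Z. c \<le> g x \<and> g x \<le> d Z}" "q \<le> card {x \<in> Z. d Z \<le> g x}"
    if "Z = X \<or> Z = Y" for Z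
  proof -
    have *: "finite {x \<in> Z. c \<le> g x}" using that fin by auto
    have "q \<le> card {x \<in> {x \<in> Z. c \<le> g x}. g x \<le> d Z}"
      unfolding d_def by (rule order_stat_halves(1)[OF * q(1) halves(2)[OF that]])
    then show "q \<le> card {x \<in> Z. c \<le> g x \<and> g x \<le> d Z}" by simp
    have "q \<le> card {x \<in> {x \<in> Z. c \<le> g x}. d Z \<le> g x}"
      unfolding d_def by (rule order_stat_halves(2)[OF * q(1) halves(2)[OF that]])
    also have "\<dots> \<le> card {x \<in> Z. d Z \<le> g x}" using that fin by (intro card_mono) auto
    finally show "q \<le> card {x \<in> Z. d Z \<le> g x}" .
  qed
  \<comment> \<open>\<open>Z\<close> provides the layer between \<open>c\<close> and
    \<open>d Z\<close>, and \<open>W\<close> the layers below \<open>c\<close> and above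
    \<open>d W\<close>.\<close>
  have main: "\<exists>A B1 B2. A \<subseteq> Z \<and> B1 \<subseteq> W \<and> B2 \<subseteq> W \<and> q \<le> card A \<and> q \<le> card B1 \<and> q \<le> card B2 \<and>
      (\<forall>a\<in>A. \<forall>b\<in>B1. g b \<le> g a) \<and> (\<forall>a\<in>A. \<forall>b\<in>B2. g a \<le> g b)"
    if "Z = X \<or> Z = Y" "W = X \<or> W = Y" "d Z \<le> d W" for Z W
  proof (intro exI conjI)
    show "q \<le> card {x \<in> Z. c \<le> g x \<and> g x \<le> d Z}" by (rule quarters(1)[OF that(1)])
    show "q \<le> card {x \<in> W. g x \<le> c}" using halves(1)[OF that(2)] by simp
    show "q \<le> card {x \<in> W. d W \<le> g x}" by (rule quarters(2)[OF that(2)])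
  qed (use that(3) in auto)
  show ?thesis
  proof (cases "d X \<le> d Y")
    case True
    then show ?thesis using main[of X Y] unfolding g_def by blast
  next
    case False
    then show ?thesis using main[of Y X] unfolding g_def by (metis linear)
  qed
qed

section \<open>Erdos-Szekeres arguments for avoiding sequences\<close>

lemma sorted_enumeration:
  fixes key :: "'a \<Rightarrow> real"
  assumes "finite A"
  obtains z where "\<And>i. i < card A \<Longrightarrow> z i \<in> A" "\<And>i j. i < card A \<Longrightarrow> j < card A \<Longrightarrow> z i = z j \<longleftrightarrow> i = j"
    "\<And>i j. i < j \<Longrightarrow> j < card A \<Longrightarrow> key (z i) \<le> key (z j)"
proof -
  obtain xs where xs: "set xs = A" "distinct xs" using finite_distinct_list[OF assms] by blast
  define ys where "ys = sort_key key xs"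
  have ys: "set ys = A" "distinct ys" "sorted (map key ys)" using xs by (simp_all add: ys_def)
  then have len: "length ys = card A" using distinct_card by fastforce
  show thesis
  proof (rule that[of "nth ys"])
    show "ys ! i \<in> A" if "i < card A" for i using that len ys(1) nth_mem by metis
    show "ys ! i = ys ! j \<longleftrightarrow> i = j" if "i < card A" "j < card A" for i j
      using that len ys(2) by (simp add: nth_eq_iff_index_eq)
    show "key (ys ! i) \<le> key (ys ! j)" if "i < j" "j < card A" for i j
      using that len ys(3) by (auto simp: sorted_iff_nth_mono_less)
  qed
qed

lemma transp_chain:
  assumes "transp R" "\<And>i. Suc i < k \<Longrightarrow> R (h i) (h (Suc i))" "i < j" "j < k"
  shows "R (h i) (h j)"
  using assms(3,4)
proof (induction j)
  case (Suc j)
  have step: "R (h j) (h (Suc j))" using assms(2) Suc.prems by simp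
  show ?case
  proof (cases "i = j")
    case False
    then have "R (h i) (h j)" using Suc by simp
    then show ?thesis using step assms(1) by (meson transpD)
  qed (use step in simp)
qed simp

text \<open>The line through two points of \<open>A\<close> avoids \<open>B1\<close> if it increases and \<open>B2\<close> if it decreases,
  with respect to the coordinates \<open>(xi, g)\<close>.\<close>
lemma one_sided_avoiding_sequence:
  fixes xi g :: "point \<Rightarrow> real"
  assumes K: "0 < K" "\<And>p q r. (xi q - xi p) * (g r - g p) - (g q - g p) * (xi r - xi p) = K * orient p q r"
    and gp: "general_position (A \<union> B1 \<union> B2)"
    and fin: "finite A" and k: "0 < k" "k * k \<le> card A"
    and sep: "\<And>a b. a \<in> A \<Longrightarrow> b \<in> B1 \<union> B2 \<Longrightarrow> xi a < xi b"
    and g1: "\<And>a b. a \<in> A \<Longrightarrow> b \<in> B1 \<Longrightarrow> g b \<le> g a"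
    and g2: "\<And>a b. a \<in> A \<Longrightarrow> b \<in> B2 \<Longrightarrow> g a \<le> g b"
  shows "\<exists>a B. (B = B1 \<or> B = B2) \<and> (\<forall>i<k. a i \<in> A) \<and>
    (\<forall>i j. i < j \<longrightarrow> j < k \<longrightarrow> (\<forall>b\<in>B. orient b (a i) (a j) > 0))"
proof -
  obtain z where z: "\<And>i. i < card A \<Longrightarrow> z i \<in> A"
      "\<And>i j. i < card A \<Longrightarrow> j < card A \<Longrightarrow> z i = z j \<longleftrightarrow> i = j"
      "\<And>i j. i < j \<Longrightarrow> j < card A \<Longrightarrow> xi (z i) \<le> xi (z j)"
    using sorted_enumeration[OF fin, of xi] by blast
  have nz: "orient (z i) (z j) b \<noteq> 0" if "i < j" "j < card A" "b \<in> B1 \<union> B2" for i j b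
  proof -
    have "z i \<noteq> b" "z j \<noteq> b" using sep[of "z i" b] sep[of "z j" b] z(1)[of i] z(1)[of j] that by auto
    then show ?thesis using that z(1)[of i] z(1)[of j] z(2)[of i j]
      by (intro orient_nonzero_if_general_position[OF gp]) auto
  qed
  \<comment> \<open>Erdos-Szekeres for \<open>g\<close> along the order of \<open>xi\<close>:
    \<open>k\<close> points with \<open>g\<close> weakly increasing, or \<open>k\<close> points with
    \<open>g\<close> strictly decreasing.\<close>
  from increasing_chain_or_independent[OF k(2) k(1), of "\<lambda>i j. g (z i) \<le> g (z j)"] show ?thesis
  proof (elim disjE exE conjE)
    fix f assume f: "\<forall>i j. i < j \<longrightarrow> j < k \<longrightarrow> f i < f j" "\<forall>i<k. f i < card A"
      "\<forall>i. Suc i < k \<longrightarrow> g (z (f i)) \<le> g (z (f (Suc i)))"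
    have mono: "g (z (f i)) \<le> g (z (f j))" if "i < j" "j < k" for i j
      using transp_chain[of "(\<le>)" k "\<lambda>i. g (z (f i))"] f(3) that by simp
    have "orient b (z (f j)) (z (f i)) > 0" if ij: "i < j" "j < k" and b: "b \<in> B1" for i j b
    proof -
      have fij: "f i < f j" "f j < card A" using f ij by auto
      have A: "z (f i) \<in> A" using z(1) fij by simp
      \<comment> \<open>By \<open>K(2)\<close>, \<open>K\<close> times the orientation is the
        difference of this product and the next; their signs follow because \<open>b\<close> lies to
        the right of \<open>A\<close> and not above it, while the pair rises.\<close>
      have "(xi (z (f j)) - xi (z (f i))) * (g b - g (z (f i))) \<le> 0"
        using z(3)[OF fij] g1[OF A b] by (intro mult_nonneg_nonpos) auto
      moreover have "(g (z (f j)) - g (z (f i))) * (xi b - xi (z (f i))) \<ge> 0"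
        using mono[OF ij] sep[OF A] b by (simp add: less_imp_le)
      ultimately have "K * orient (z (f i)) (z (f j)) b \<le> 0" using K(2)[of "z (f j)" "z (f i)" b] by linarith
      then have "orient (z (f i)) (z (f j)) b \<le> 0" using K(1) by (simp add: mult_le_0_iff)
      then have "orient (z (f i)) (z (f j)) b < 0" using nz[OF fij, of b] b by simp
      moreover have "orient b (z (f j)) (z (f i)) = - orient (z (f i)) (z (f j)) b"
        by (simp add: orient_def cross2_def algebra_simps)
      ultimately show ?thesis by simp
    qed
    \<comment> \<open>From \<open>B1\<close> the rising sequence is seen clockwise, so it is listed
      backwards.\<close>
    then show ?thesis using f z(1)
      by (intro exI[of _ "\<lambda>i. z (f (k - 1 - i))"] exI[of _ B1]) auto
  next
    fix D assume D: "D \<subseteq> {..<card A}" "k \<le> card D"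
      "\<forall>i\<in>D. \<forall>j\<in>D. i < j \<longrightarrow> \<not> g (z i) \<le> g (z j)"
    obtain f where f: "\<And>i j. i < j \<Longrightarrow> j < k \<Longrightarrow> f i < f j" "\<And>i. i < k \<Longrightarrow> f i \<in> D"
      using finite_nat_set_enumeration[OF _ D(2)] finite_subset[OF D(1)] by blast
    have "orient b (z (f i)) (z (f j)) > 0" if ij: "i < j" "j < k" and b: "b \<in> B2" for i j b
    proof -
      have fij: "f i < f j" "f i \<in> D" "f j \<in> D" using f ij by auto
      then have fj: "f j < card A" using D by auto
      have A: "z (f i) \<in> A" using z(1) fij fj by simp
      have less: "g (z (f j)) < g (z (f i))" using D(3) fij by force
      have "(xi (z (f j)) - xi (z (f i))) * (g b - g (z (f i))) \<ge> 0"
        using z(3)[OF fij(1) fj] g2[OF A b] by simp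
      moreover have "(g (z (f j)) - g (z (f i))) * (xi b - xi (z (f i))) < 0"
        using less sep[OF A] b by (intro mult_neg_pos) auto
      ultimately have "K * orient (z (f i)) (z (f j)) b > 0" using K(2)[of "z (f j)" "z (f i)" b] by linarith
      then have "orient (z (f i)) (z (f j)) b > 0" using K(1) by (simp add: zero_less_mult_iff)
      then show ?thesis by (simp add: orient_rotate[of b])
    qed
    moreover have "z (f i) \<in> A" if "i < k" for i using z(1) f(2)[OF that] D by auto
    ultimately show ?thesis
      by (intro exI[of _ "\<lambda>i. z (f i)"] exI[of _ B2]) auto
  qed
qed

text \<open>Cramer's rule writes \<open>cross2 u w\<close> times \<open>v\<close> as a combination
  of \<open>u\<close> and \<open>w\<close>; applying \<open>cross2 x\<close> gives the identity. It
  transfers orientation signs from two points of a sequence to a third.\<close>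

lemma cross2_identity: "cross2 u w * cross2 x v = cross2 v w * cross2 x u + cross2 u v * cross2 x w"
  by (simp add: cross2_def algebra_simps)

text \<open>A line through two points of \<open>B\<close> separates the sequence \<open>a\<close> in at most one place.  If it does
  not separate \<open>a 0\<close> from the middle \<open>a mu\<close>, it avoids the first half of \<open>a\<close>; otherwise it
  avoids the second half.\<close>
lemma two_sided_avoiding_sequence:
  assumes fin: "finite B" and gp: "general_position P" "B \<subseteq> P" "\<And>i. i < 2 * k \<Longrightarrow> a i \<in> P"
    and k: "0 < k" "k * k \<le> card B"
    and d: "\<And>i b. i < 2 * k \<Longrightarrow> b \<in> B \<Longrightarrow> cross2 d (b - a i) > 0"
    and av: "\<And>i j b. i < j \<Longrightarrow> j < 2 * k \<Longrightarrow> b \<in> B \<Longrightarrow> orient b (a i) (a j) > 0"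
  shows "\<exists>a' b. avoiding_pair k a' b \<and> (\<forall>i<k. \<exists>l<2 * k. a' i = a l) \<and> (\<forall>i<k. b i \<in> B)"
proof -
  \<comment> \<open>The two halves are the indices \<open>0..mu\<close> and
    \<open>mu..mu + k - 1\<close>; they share \<open>mu\<close>.\<close>
  define mu where "mu = k - 1"
  define key where "key = (\<lambda>l z. angle_key d (z - a l))"
  have mu: "mu < 2 * k" using k by (simp add: mu_def)
  have orient_key: "orient (a l) b b' < 0 \<longleftrightarrow> key l b < key l b'" "orient (a l) b b' > 0 \<longleftrightarrow> key l b' < key l b"
    if "l < 2 * k" "b \<in> B" "b' \<in> B" for l b b'
    unfolding orient_def key_def
    using cross2_pos_iff_angle_key[OF d d] cross2_neg_iff_angle_key[OF d d] that by simp_all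
  have nz: "orient (a l) b b' \<noteq> 0" if "l < 2 * k" "b \<in> B" "b' \<in> B" "b \<noteq> b'" for l b b'
  proof -
    have "a l \<noteq> b" "a l \<noteq> b'" using d[of l b] d[of l b'] that by (auto simp: cross2_def)
    then show ?thesis using that gp by (intro orient_nonzero_if_general_position[OF gp(1)]) auto
  qed
  obtain z where z: "\<And>i. i < card B \<Longrightarrow> z i \<in> B"
      "\<And>i j. i < card B \<Longrightarrow> j < card B \<Longrightarrow> z i = z j \<longleftrightarrow> i = j"
      "\<And>i j. i < j \<Longrightarrow> j < card B \<Longrightarrow> key 0 (z i) \<le> key 0 (z j)"
    using sorted_enumeration[OF fin, of "key 0"] by blast
  have or0: "orient (a 0) (z i) (z j) < 0" if "i < j" "j < card B" for i j
    using orient_key(2)[of 0 "z i" "z j"] nz[of 0 "z i" "z j"] z(1)[of i] z(1)[of j] z(2)[of i j] z(3)[OF that] that k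
    by force
  have move: "orient (a l) b b' = cross2 (b' - b) (a l - b)" for l b b'
    by (simp add: orient_def cross2_def algebra_simps)
  have av': "cross2 (a i - b) (a j - b) > 0" if "i < j" "j < 2 * k" "b \<in> B" for i j b
    using av[OF that] by (simp add: orient_def)
  \<comment> \<open>\<open>B\<close> is already sorted around \<open>a 0\<close>; this compares with
    its order around \<open>a mu\<close>, giving \<open>k\<close> points in the same order or
    \<open>k\<close> points in the reversed order.\<close>
  from increasing_chain_or_independent[OF k(2) k(1), of "\<lambda>i j. key mu (z i) < key mu (z j)"] show ?thesis
  proof (elim disjE exE conjE)
    fix f assume f: "\<forall>i j. i < j \<longrightarrow> j < k \<longrightarrow> f i < f j" "\<forall>i<k. f i < card B"
      "\<forall>i. Suc i < k \<longrightarrow> key mu (z (f i)) < key mu (z (f (Suc i)))"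
    have mono: "key mu (z (f i)) < key mu (z (f j))" if "i < j" "j < k" for i j
      using transp_chain[of "(<)" k "\<lambda>i. key mu (z (f i))"] f(3) that by simp
    have "orient (a l) (z (f i)) (z (f j)) < 0" if ij: "i < j" "j < k" and l: "l < k" for i j l
    proof -
      have fij: "f i < f j" "f j < card B" "f i < card B" using f ij by auto
      let ?b = "z (f i)" and ?b' = "z (f j)"
      have B: "?b \<in> B" "?b' \<in> B" using z(1) fij by auto
      have h0: "orient (a 0) ?b ?b' < 0" by (rule or0[OF fij(1,2)])
      have hm: "orient (a mu) ?b ?b' < 0" using orient_key(1)[OF mu B] mono[OF ij] by simp
      consider "l = 0" | "l = mu" | "0 < l" "l < mu" using l unfolding mu_def by linarith
      then show ?thesis
      proof cases
        case 3
        \<comment> \<open>Around \<open>?b\<close>, \<open>a l\<close> lies between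
          \<open>a 0\<close> and \<open>a mu\<close>, so its orientation is a positive combination
          of two negative ones.\<close>
        then have c: "cross2 (a 0 - ?b) (a l - ?b) > 0" "cross2 (a l - ?b) (a mu - ?b) > 0"
            "cross2 (a 0 - ?b) (a mu - ?b) > 0"
          using av' B(1) mu by auto
        have "cross2 (a l - ?b) (a mu - ?b) * orient (a 0) ?b ?b' < 0"
          using c h0 by (intro mult_pos_neg)
        moreover have "cross2 (a 0 - ?b) (a l - ?b) * orient (a mu) ?b ?b' < 0"
          using c hm by (intro mult_pos_neg)
        ultimately have "cross2 (a 0 - ?b) (a mu - ?b) * orient (a l) ?b ?b' < 0"
          unfolding move cross2_identity[of "a 0 - ?b" "a mu - ?b" _ "a l - ?b"] by linarith
        then show ?thesis using c(3) by (simp add: mult_less_0_iff)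
      qed (use h0 hm in auto)
    qed
    then have "avoiding_pair k a (\<lambda>i. z (f i))"
      using av z(1) f unfolding avoiding_pair_def by simp
    moreover have "\<forall>i<k. \<exists>l<2 * k. a i = a l" by (metis mult_2 trans_less_add1)
    ultimately show ?thesis using z(1) f
      by (intro exI[of _ a] exI[of _ "\<lambda>i. z (f i)"]) simp
  next
    fix D assume D: "D \<subseteq> {..<card B}" "k \<le> card D"
      "\<forall>i\<in>D. \<forall>j\<in>D. i < j \<longrightarrow> \<not> key mu (z i) < key mu (z j)"
    obtain f where f: "\<And>i j. i < j \<Longrightarrow> j < k \<Longrightarrow> f i < f j" "\<And>i. i < k \<Longrightarrow> f i \<in> D"
      using finite_nat_set_enumeration[OF _ D(2)] finite_subset[OF D(1)] by blast
    have fB: "f i < card B" if "i < k" for i using f(2)[OF that] D by auto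
    have pos: "orient (a l) (z (f i)) (z (f j)) > 0" if ij: "i < j" "j < k" and l: "mu \<le> l" "l < 2 * k" for i j l
    proof -
      have fij: "f i < f j" "f j < card B" "f i < card B" using f fB ij by auto
      let ?b = "z (f i)" and ?b' = "z (f j)"
      have B: "?b \<in> B" "?b' \<in> B" using z(1) fij by auto
      have h0: "orient (a 0) ?b ?b' < 0" by (rule or0[OF fij(1,2)])
      have "\<not> key mu ?b < key mu ?b'" using D(3) f ij by simp
      then have hm: "orient (a mu) ?b ?b' > 0"
        using orient_key(1)[OF mu B] nz[OF mu B] z(2)[OF fij(3,2)] fij(1) by linarith
      show ?thesis
      proof (cases "l = mu")
        case False
        then have lmu: "mu < l" using l by simp
        have "mu \<noteq> 0" using h0 hm by (metis less_asym)
        then have c: "cross2 (a 0 - ?b) (a l - ?b) > 0" "cross2 (a mu - ?b) (a l - ?b) > 0"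
            "cross2 (a 0 - ?b) (a mu - ?b) > 0"
          using av' B(1) mu lmu l by auto
        \<comment> \<open>Now \<open>a l\<close> lies beyond \<open>a mu\<close>: the coefficient at
          \<open>a 0\<close> is negative, and so is the orientation there, so both terms are
          positive.\<close>
        have "cross2 (a l - ?b) (a mu - ?b) < 0" using c(2) by (simp add: cross2_def algebra_simps)
        then have "cross2 (a l - ?b) (a mu - ?b) * orient (a 0) ?b ?b' > 0"
          using h0 by (rule mult_neg_neg)
        moreover have "cross2 (a 0 - ?b) (a l - ?b) * orient (a mu) ?b ?b' > 0"
          using c hm by simp
        ultimately have "cross2 (a 0 - ?b) (a mu - ?b) * orient (a l) ?b ?b' > 0"
          unfolding move cross2_identity[of "a 0 - ?b" "a mu - ?b" _ "a l - ?b"] by linarith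
        then show ?thesis using c(3) by (simp add: zero_less_mult_iff)
      qed (use hm in auto)
    qed
    \<comment> \<open>From the second half the chosen points of \<open>B\<close> are seen
      counterclockwise, so they are listed backwards.\<close>
    have "avoiding_pair k (\<lambda>i. a (mu + i)) (\<lambda>i. z (f (k - 1 - i)))"
      unfolding avoiding_pair_def
    proof (intro allI impI conjI)
      fix i j l assume ijl: "i < j" "j < k" "l < k"
      show "orient (z (f (k - 1 - l))) (a (mu + i)) (a (mu + j)) > 0"
        using ijl z(1)[OF fB] mu by (intro av) (auto simp: mu_def)
      have "orient (a (mu + l)) (z (f (k - 1 - j))) (z (f (k - 1 - i))) > 0"
        using ijl by (intro pos) (auto simp: mu_def)
      then show "orient (a (mu + l)) (z (f (k - 1 - i))) (z (f (k - 1 - j))) < 0"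
        using orient_swap[of "a (mu + l)" "z (f (k - 1 - i))" "z (f (k - 1 - j))"] by linarith
    qed
    moreover have "\<exists>l<2 * k. a (mu + i) = a l" if "i < k" for i
      using that by (intro exI[of _ "mu + i"]) (simp add: mu_def)
    moreover have "\<forall>i<k. z (f (k - 1 - i)) \<in> B" using z(1)[OF fB] by simp
    ultimately show ?thesis by blast
  qed
qed

text \<open>\<open>16 * k\<^sup>2\<close> is four times \<open>(2 * k)\<^sup>2\<close>: the triple
  keeps a quarter, the first Erdos-Szekeres step extracts \<open>2 * k\<close> points of
  \<open>A\<close>, and the second \<open>k\<close> points of \<open>B\<close> together with half of
  these.\<close>

lemma mutually_avoiding_subsets:
  assumes fin: "finite X" "finite Y" and gp: "general_position (X \<union> Y)"
    and sep: "\<And>x y. x \<in> X \<Longrightarrow> y \<in> Y \<Longrightarrow> cross2 d x < cross2 d y"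
    and k: "0 < k" "16 * k\<^sup>2 \<le> card X" "16 * k\<^sup>2 \<le> card Y"
  shows "\<exists>a b. avoiding_pair k a b \<and>
    ((\<forall>i<k. a i \<in> X \<and> b i \<in> Y) \<or> (\<forall>i<k. a i \<in> Y \<and> b i \<in> X))"
proof -
  define q where "q = 4 * k\<^sup>2"
  define eta where "eta = (\<lambda>p :: point. - (fst d * fst p + snd d * snd p))"
  have q: "0 < q" "4 * q \<le> card X" "4 * q \<le> card Y" using k by (simp_all add: q_def)
  obtain s A B1 B2 where
    AB: "A \<subseteq> X \<and> B1 \<subseteq> Y \<and> B2 \<subseteq> Y \<or> A \<subseteq> Y \<and> B1 \<subseteq> X \<and> B2 \<subseteq> X"
    and card: "q \<le> card A" "q \<le> card B1" "q \<le> card B2"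
    and B1: "\<forall>a\<in>A. \<forall>b\<in>B1. eta b - s * cross2 d b \<le> eta a - s * cross2 d a"
    and B2: "\<forall>a\<in>A. \<forall>b\<in>B2. eta a - s * cross2 d a \<le> eta b - s * cross2 d b"
  proof -
    have "\<exists>s A B1 B2. (A \<subseteq> X \<and> B1 \<subseteq> Y \<and> B2 \<subseteq> Y \<or> A \<subseteq> Y \<and> B1 \<subseteq> X \<and> B2 \<subseteq> X) \<and>
      q \<le> card A \<and> q \<le> card B1 \<and> q \<le> card B2 \<and>
      (\<forall>a\<in>A. \<forall>b\<in>B1. eta b - s * cross2 d b \<le> eta a - s * cross2 d a) \<and>
      (\<forall>a\<in>A. \<forall>b\<in>B2. eta a - s * cross2 d a \<le> eta b - s * cross2 d b)"
      by (rule separated_triple[OF fin q]) (rule sep)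
    then show thesis by (elim exE conjE) (rule that)
  qed
  define g where "g = (\<lambda>p. eta p - s * cross2 d p)"
  define K where "K = (fst d)\<^sup>2 + (snd d)\<^sup>2"
  have "X \<noteq> {}" "Y \<noteq> {}" using q by auto
  then obtain x y where "x \<in> X" "y \<in> Y" by blast
  then have "d \<noteq> 0" using sep[of x y] by (auto simp: cross2_def)
  then have K: "K > 0" by (simp add: K_def sum_power2_gt_zero_iff prod_eq_iff)
  \<comment> \<open>\<open>cross2 d\<close> and \<open>eta\<close> form a rotated and scaled
    coordinate system of determinant \<open>K\<close>; subtracting \<open>s * cross2 d\<close> is a
    shear, so \<open>s\<close> drops out.\<close>
  have det: "(cross2 d q - cross2 d p) * (g r - g p) - (g q - g p) * (cross2 d r - cross2 d p) = K * orient p q r"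
    for p q r
    by (simp add: g_def eta_def K_def orient_def cross2_def power2_eq_square algebra_simps)
  have finAB: "finite A" "finite B1" "finite B2" using AB fin finite_subset by metis+
  have AB_sub: "A \<union> B1 \<union> B2 \<subseteq> X \<union> Y" using AB by blast
  have gpAB: "general_position (A \<union> B1 \<union> B2)" by (rule general_position_subset[OF gp AB_sub])
  have gpBA: "general_position (A \<union> B2 \<union> B1)" using gpAB by (simp add: ac_simps)
  have kk: "2 * k * (2 * k) \<le> card A" using card by (simp add: q_def power2_eq_square)
  have k2: "0 < 2 * k" using k by simp
  have g1: "g b \<le> g a" if "a \<in> A" "b \<in> B1" for a b using B1 that by (simp add: g_def)
  have g2: "g a \<le> g b" if "a \<in> A" "b \<in> B2" for a b using B2 that by (simp add: g_def)
  have "\<exists>a B e. (B = B1 \<or> B = B2) \<and> (\<forall>i<2*k. a i \<in> A) \<and>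
      (\<forall>i j. i < j \<longrightarrow> j < 2*k \<longrightarrow> (\<forall>b\<in>B. orient b (a i) (a j) > 0)) \<and>
      (\<forall>a\<in>A. \<forall>b\<in>B1 \<union> B2. cross2 e (b - a) > 0)"
    using AB
  proof
    assume *: "A \<subseteq> X \<and> B1 \<subseteq> Y \<and> B2 \<subseteq> Y"
    have s: "cross2 d a < cross2 d b" if "a \<in> A" "b \<in> B1 \<union> B2" for a b
      by (rule sep) (use * that in auto)
    then have pos: "\<forall>a\<in>A. \<forall>b\<in>B1 \<union> B2. cross2 d (b - a) > 0"
      by (simp add: cross2_diff_right)
    have "\<exists>a B. (B = B1 \<or> B = B2) \<and> (\<forall>i<2*k. a i \<in> A) \<and>
        (\<forall>i j. i < j \<longrightarrow> j < 2*k \<longrightarrow> (\<forall>b\<in>B. orient b (a i) (a j) > 0))"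
    proof (rule one_sided_avoiding_sequence[where xi = "cross2 d" and g = g,
          OF K det gpAB finAB(1) k2 kk])
      show "cross2 d a < cross2 d b" if "a \<in> A" "b \<in> B1 \<union> B2" for a b
        by (rule s[OF that])
    qed (use g1 g2 in simp_all)
    then obtain a B where "B = B1 \<or> B = B2" "\<forall>i<2*k. a i \<in> A"
        "\<forall>i j. i < j \<longrightarrow> j < 2*k \<longrightarrow> (\<forall>b\<in>B. orient b (a i) (a j) > 0)"
      by (elim exE conjE)
    then show ?thesis using pos
      by (intro exI[of _ a] exI[of _ B] exI[of _ d]) simp
  next
    assume *: "A \<subseteq> Y \<and> B1 \<subseteq> X \<and> B2 \<subseteq> X"
    have s: "- cross2 d a < - cross2 d b" if "a \<in> A" "b \<in> B1 \<union> B2" for a b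
    proof -
      have "cross2 d b < cross2 d a" by (rule sep) (use * that in auto)
      then show ?thesis by simp
    qed
    have pos: "\<forall>a\<in>A. \<forall>b\<in>B1 \<union> B2. cross2 (- d) (b - a) > 0"
      using s by (simp add: cross2_def algebra_simps)
    \<comment> \<open>With \<open>A\<close> on the far side both coordinates are negated. This
      half-turn preserves orientations, but reverses \<open>g\<close> and so exchanges
      \<open>B1\<close> and \<open>B2\<close>.\<close>
    have det': "(- cross2 d q - - cross2 d p) * (- g r - - g p) - (- g q - - g p) * (- cross2 d r - - cross2 d p)
        = K * orient p q r" for p q r
      unfolding det[symmetric] by (simp add: algebra_simps)
    have "\<exists>a B. (B = B2 \<or> B = B1) \<and> (\<forall>i<2*k. a i \<in> A) \<and>
        (\<forall>i j. i < j \<longrightarrow> j < 2*k \<longrightarrow> (\<forall>b\<in>B. orient b (a i) (a j) > 0))"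
    proof (rule one_sided_avoiding_sequence[where xi = "\<lambda>p. - cross2 d p" and g = "\<lambda>p. - g p",
          OF K det' gpBA finAB(1) k2 kk])
      show "- cross2 d a < - cross2 d b" if "a \<in> A" "b \<in> B2 \<union> B1" for a b
        using s[of a b] that by blast
    qed (use g1 g2 in simp_all)
    then obtain a B where "B = B2 \<or> B = B1" "\<forall>i<2*k. a i \<in> A"
        "\<forall>i j. i < j \<longrightarrow> j < 2*k \<longrightarrow> (\<forall>b\<in>B. orient b (a i) (a j) > 0)"
      by (elim exE conjE)
    moreover from this(1) have "B = B1 \<or> B = B2" by blast
    ultimately show ?thesis using pos
      by (intro exI[of _ a] exI[of _ B] exI[of _ "- d"]) simp
  qed
  then obtain a B e where B: "B = B1 \<or> B = B2" and a: "\<forall>i<2*k. a i \<in> A"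
    and av: "\<forall>i j. i < j \<longrightarrow> j < 2 * k \<longrightarrow> (\<forall>b\<in>B. orient b (a i) (a j) > 0)"
    and e: "\<forall>a\<in>A. \<forall>b\<in>B1 \<union> B2. cross2 e (b - a) > 0"
    by (elim exE conjE)
  have cardB: "k * k \<le> card B" using B card by (auto simp: q_def power2_eq_square)
  have "\<exists>a' b. avoiding_pair k a' b \<and> (\<forall>i<k. \<exists>l<2 * k. a' i = a l) \<and> (\<forall>i<k. b i \<in> B)"
  proof (rule two_sided_avoiding_sequence[of B "X \<union> Y" k a e])
    show "finite B" "B \<subseteq> X \<union> Y" using B finAB AB_sub by auto
    show "a i \<in> X \<union> Y" if "i < 2 * k" for i using a that AB_sub by blast
    show "0 < cross2 e (b - a i)" if "i < 2 * k" "b \<in> B" for i b using e a that B by auto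
    show "0 < orient b (a i) (a j)" if "i < j" "j < 2 * k" "b \<in> B" for i j b using av that by blast
  qed (use gp k cardB in auto)
  then obtain a' b where ab: "avoiding_pair k a' b" "\<forall>i<k. \<exists>l<2 * k. a' i = a l" "\<forall>i<k. b i \<in> B" by blast
  have "a' i \<in> A" if "i < k" for i using ab(2) a that by force
  then show ?thesis using ab(1,3) AB B by (intro exI[of _ a'] exI[of _ b]) blast
qed

section \<open>The Ramsey argument\<close>

lemma ladder_drawing_inj:
  assumes "ladder_drawing n c" "i < n" "j < n"
  shows "c s i = c t j \<longleftrightarrow> s = t \<and> i = j"
proof -
  have "inj_on (\<lambda>(s, i). c s i) (UNIV \<times> {..<n})"
    using assms(1) unfolding ladder_drawing_def by (rule conjunct1)
  from inj_on_eq_iff[OF this, of "(s, i)" "(t, j)"] show ?thesis using assms by simp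
qed

lemma avoiding_pair_copy:
  assumes "avoiding_pair n a b" "\<And>i. i < n \<Longrightarrow> a i \<in> P \<and> b i \<in> P"
    "\<And>i j. i < n \<Longrightarrow> j < n \<Longrightarrow> a i \<noteq> b j"
    "\<And>i. Suc i < n \<Longrightarrow> chi {a i, a (Suc i)} = col \<and> chi {b i, b (Suc i)} = col"
    "\<And>i. i < n \<Longrightarrow> chi {a i, b i} = col"
  shows "\<exists>phi. mono_noncrossing_copy (ladder_V n) (ladder_E n) P chi phi"
proof -
  have "ladder_drawing n (\<lambda>s. if s then b else a)"
    by (rule avoiding_pair_ladder_drawing[OF assms(1)]) (rule assms(3))
  then have "mono_noncrossing_copy (ladder_V n) (ladder_E n) P chi
      (\<lambda>(s, i). (if s then b else a) (i - 1))"
    by (rule ladder_drawing_copy[where col = col]) (use assms(2,4,5) in auto)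
  then show ?thesis by blast
qed

text \<open>The number of elements of \<open>S\<close> below \<open>c\<close> determines
  \<open>c\<close>, so at most \<open>K\<close> elements fail the first condition; likewise for the
  second.\<close>

lemma card_central_elements:
  fixes S :: "nat set"
  assumes "finite S"
  shows "card S \<le> card {c \<in> S. K \<le> card (S \<inter> {..<c}) \<and> K \<le> card (S \<inter> {c..})} + 2 * K"
proof -
  let ?M = "{c \<in> S. K \<le> card (S \<inter> {..<c}) \<and> K \<le> card (S \<inter> {c..})}"
  let ?L = "{c \<in> S. card (S \<inter> {..<c}) < K}" and ?U = "{c \<in> S. card (S \<inter> {c..}) < K}"
  have lt: "card (S \<inter> {..<c}) < card (S \<inter> {..<c'})" "card (S \<inter> {c'..}) < card (S \<inter> {c..})"
    if "c \<in> S" "c' \<in> S" "c < c'" for c c'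
  proof -
    have "c \<in> S \<inter> {..<c'} - S \<inter> {..<c}" "c \<in> S \<inter> {c..} - S \<inter> {c'..}" using that by auto
    moreover have "S \<inter> {..<c} \<subseteq> S \<inter> {..<c'}" "S \<inter> {c'..} \<subseteq> S \<inter> {c..}" using that(3) by auto
    ultimately have "S \<inter> {..<c} \<subset> S \<inter> {..<c'}" "S \<inter> {c'..} \<subset> S \<inter> {c..}" by blast+
    then show "card (S \<inter> {..<c}) < card (S \<inter> {..<c'})" "card (S \<inter> {c'..}) < card (S \<inter> {c..})"
      using assms by (auto intro: psubset_card_mono)
  qed
  have "inj_on (\<lambda>c. card (S \<inter> {..<c})) ?L"
    by (intro linorder_inj_onI' less_imp_neq lt(1)) auto
  moreover have "(\<lambda>c. card (S \<inter> {..<c})) ` ?L \<subseteq> {..<K}" by auto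
  ultimately have L: "card ?L \<le> K" using card_inj_on_le[of _ ?L "{..<K}"] by simp
  have "inj_on (\<lambda>c. card (S \<inter> {c..})) ?U"
    by (intro linorder_inj_onI' less_imp_neq[symmetric] lt(2)) auto
  moreover have "(\<lambda>c. card (S \<inter> {c..})) ` ?U \<subseteq> {..<K}" by auto
  ultimately have U: "card ?U \<le> K" using card_inj_on_le[of _ ?U "{..<K}"] by simp
  have "card S \<le> card (?M \<union> ?L \<union> ?U)" using assms by (intro card_mono) auto
  also have "\<dots> \<le> card (?M \<union> ?L) + card ?U" by (rule card_Un_le)
  also have "card (?M \<union> ?L) \<le> card ?M + card ?L" by (rule card_Un_le)
  finally show ?thesis using L U by simp
qed

text \<open>Each \<open>S i\<close> loses at most \<open>2 * K\<close> noncentral elements, so at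
  least \<open>m * l\<close> pairs \<open>(i, c)\<close> with \<open>c\<close> central in
  \<open>S i\<close> remain, and some \<open>c < m\<close> occurs in \<open>l\<close> of
  them.\<close>

lemma common_central_element:
  fixes S :: "nat \<Rightarrow> nat set"
  assumes S: "\<And>i. i < m \<Longrightarrow> S i \<subseteq> {..<m}"
    and card: "m * (2 * K + l) \<le> (\<Sum>i<m. card (S i))" and "0 < m" "0 < l"
  obtains c where "l \<le> card {i \<in> {..<m}. K \<le> card (S i \<inter> {..<c}) \<and> K \<le> card (S i \<inter> {c..})}"
proof -
  define C where "C = (\<lambda>i c. K \<le> card (S i \<inter> {..<c}) \<and> K \<le> card (S i \<inter> {c..}))"
  have le: "card (S i) \<le> card {c \<in> {..<m}. C i c} + 2 * K" if "i < m" for i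
  proof -
    have "finite (S i)" using S[OF that] finite_subset by blast
    from card_central_elements[OF this, of K] have "card (S i) \<le> card {c \<in> S i. C i c} + 2 * K"
      by (simp add: C_def)
    also have "card {c \<in> S i. C i c} \<le> card {c \<in> {..<m}. C i c}" using S[OF that] by (intro card_mono) auto
    finally show ?thesis by simp
  qed
  have "(\<Sum>i<m. card (S i)) \<le> (\<Sum>i<m. card {c \<in> {..<m}. C i c} + 2 * K)" using le by (intro sum_mono) simp
  also have "\<dots> = (\<Sum>i<m. card {c \<in> {..<m}. C i c}) + m * (2 * K)" by (simp add: sum.distrib)
  finally have "m * l \<le> (\<Sum>i<m. card {c \<in> {..<m}. C i c})" using card by (simp add: algebra_simps)
  also have "\<dots> = (\<Sum>i<m. \<Sum>c<m. if C i c then 1 else 0)"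
    by (intro sum.cong) (simp_all add: sum.inter_filter[symmetric])
  also have "\<dots> = (\<Sum>c<m. \<Sum>i<m. if C i c then 1 else 0)" by (rule sum.swap)
  also have "\<dots> = (\<Sum>c<m. card {i \<in> {..<m}. C i c})"
    by (intro sum.cong) (simp_all add: sum.inter_filter[symmetric])
  finally have total: "m * l \<le> (\<Sum>c<m. card {i \<in> {..<m}. C i c})" .
  have "\<exists>c<m. l \<le> card {i \<in> {..<m}. C i c}"
  proof (rule ccontr)
    assume "\<not> ?thesis"
    then have "card {i \<in> {..<m}. C i c} \<le> l - 1" if "c \<in> {..<m}" for c using that by force
    then have "(\<Sum>c<m. card {i \<in> {..<m}. C i c}) \<le> m * (l - 1)"
      using sum_bounded_above[of "{..<m}" "\<lambda>c. card {i \<in> {..<m}. C i c}" "l - 1"] by simp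
    then have "m * l \<le> m * (l - 1)" using total by (rule order_trans[rotated])
    then show False using assms(3,4) by simp
  qed
  then show thesis using that unfolding C_def by blast
qed

section \<open>Consequences of a colouring without a monochromatic ladder\<close>

locale ladder_free =
  fixes n :: nat and P :: "point set" and chi :: "point set \<Rightarrow> bool"
  assumes n: "0 < n" and finite_P: "finite P" and gp: "general_position P"
    and no_copy: "\<not> (\<exists>phi. mono_noncrossing_copy (ladder_V n) (ladder_E n) P chi phi)"
begin

lemma edge_of_colour:
  assumes "Q \<subseteq> P" "2 * n \<le> card Q"
  shows "\<exists>x\<in>Q. \<exists>y\<in>Q. x \<noteq> y \<and> chi {x, y} = col"
proof (rule ccontr)
  assume "\<not> ?thesis"
  then have col: "chi {x, y} = (\<not> col)" if "x \<in> Q" "y \<in> Q" "x \<noteq> y" for x y using that by blast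
  have "finite Q" "general_position Q"
    using assms(1) finite_P gp finite_subset general_position_subset by blast+
  then obtain c where c: "ladder_drawing n c" "\<And>s i. i < n \<Longrightarrow> c s i \<in> Q"
    using ladder_drawing_in_general_position[of Q n] assms(2) n by blast
  note inj = ladder_drawing_inj[OF c(1)]
  have "mono_noncrossing_copy (ladder_V n) (ladder_E n) P chi (\<lambda>(s, i). c s (i - 1))"
  proof (rule ladder_drawing_copy[OF c(1), where col = "\<not> col"])
    show "c s i \<in> P" if "i < n" for s i using c(2)[OF that] assms(1) by blast
    show "chi {c s i, c s (Suc i)} = (\<not> col)" if "Suc i < n" for s i
      using that by (intro col c(2)) (auto simp: inj)
    show "chi {c False i, c True i} = (\<not> col)" if "i < n" for i
      using that by (intro col c(2)) (auto simp: inj)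
  qed
  then show False using no_copy by blast
qed

text \<open>Otherwise there are \<open>2 * n\<close> points among which no edge has colour
  \<open>col\<close>, against \<open>edge_of_colour\<close>.\<close>

lemma path_of_colour:
  assumes P: "\<And>i. i < m \<Longrightarrow> a i \<in> P" and inj: "\<And>i j. i < m \<Longrightarrow> j < m \<Longrightarrow> a i = a j \<longleftrightarrow> i = j"
    and m: "n * (2 * n) \<le> m"
  shows "\<exists>f. (\<forall>i j. i < j \<longrightarrow> j < n \<longrightarrow> f i < f j) \<and> (\<forall>i<n. f i < m) \<and>
    (\<forall>i. Suc i < n \<longrightarrow> chi {a (f i), a (f (Suc i))} = col)"
proof -
  have "0 < 2 * n" using n by simp
  from increasing_chain_or_independent[OF m this, of "\<lambda>i j. chi {a i, a j} = col"] show ?thesis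
  proof (rule disjE)
    assume "\<exists>D\<subseteq>{..<m}. 2 * n \<le> card D \<and> (\<forall>i\<in>D. \<forall>j\<in>D. i < j \<longrightarrow> chi {a i, a j} \<noteq> col)"
    then obtain D where D: "D \<subseteq> {..<m}" "2 * n \<le> card D"
        "\<And>i j. i \<in> D \<Longrightarrow> j \<in> D \<Longrightarrow> i < j \<Longrightarrow> chi {a i, a j} \<noteq> col" by blast
    have "inj_on a D" using inj D(1) by (intro inj_onI) auto
    then have "2 * n \<le> card (a ` D)" using D(2) by (simp add: card_image)
    moreover have "a ` D \<subseteq> P" using P D(1) by auto
    ultimately obtain i j where ij: "i \<in> D" "j \<in> D" "a i \<noteq> a j" "chi {a i, a j} = col"
      using edge_of_colour[of "a ` D" col] by blast
    have "i \<noteq> j" using ij(3) by auto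
    then have False using D(3)[OF ij(1,2)] D(3)[OF ij(2,1)] ij(4)
      by (metis insert_commute linorder_neqE_nat)
    then show ?thesis ..
  qed
qed

text \<open>The paths in the two rows are found independently, so any \<open>a i\<close> may have to
  be joined to any \<open>b j\<close>; hence the colour is required for all pairs.\<close>

lemma no_monochromatic_avoiding_pair:
  assumes ab: "avoiding_pair m a b" and P: "\<And>i. i < m \<Longrightarrow> a i \<in> P \<and> b i \<in> P"
    and ne: "\<And>i j. i < m \<Longrightarrow> j < m \<Longrightarrow> a i \<noteq> b j"
    and m: "n * (2 * n) \<le> m"
    and col: "\<And>i j. i < m \<Longrightarrow> j < m \<Longrightarrow> chi {a i, b j} = col"
  shows False
proof -
  obtain f where f: "\<forall>i j. i < j \<longrightarrow> j < n \<longrightarrow> f i < f j" "\<forall>i<n. f i < m"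
    "\<forall>i. Suc i < n \<longrightarrow> chi {a (f i), a (f (Suc i))} = col"
    using path_of_colour[of m a col] P avoiding_pair_inj(1)[OF ab] m by auto
  obtain g where g: "\<forall>i j. i < j \<longrightarrow> j < n \<longrightarrow> g i < g j" "\<forall>i<n. g i < m"
    "\<forall>i. Suc i < n \<longrightarrow> chi {b (g i), b (g (Suc i))} = col"
    using path_of_colour[of m b col] P avoiding_pair_inj(2)[OF ab] m by auto
  have "avoiding_pair n (a \<circ> f) (b \<circ> g)" using f g by (intro avoiding_pair_sub[OF ab]) auto
  then have "\<exists>phi. mono_noncrossing_copy (ladder_V n) (ladder_E n) P chi phi"
    by (rule avoiding_pair_copy[where col = col]) (use f g P ne col in simp_all)
  then show False using no_copy by blast
qed

text \<open>\<open>d\<close> is parallel to the line through \<open>a i\<close> and the first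
  \<open>b t\<close> with \<open>t\<close> in \<open>T\<close>. This line has \<open>b j\<close>
  strictly on one side for \<open>j < t\<close> and weakly on the other for \<open>j\<close> in
  \<open>T\<close>.\<close>

lemma separated_classes:
  assumes ab: "avoiding_pair m a b" and i: "i < m" and S: "S \<subseteq> {..<c}" "T \<subseteq> {c..<m}" "T \<noteq> {}"
  obtains d where "\<And>j j'. j \<in> S \<Longrightarrow> j' \<in> T \<Longrightarrow> cross2 d (b j) < cross2 d (b j')"
proof -
  have finT: "finite T" using S(2) finite_subset by blast
  define t where "t = Min T"
  have t: "t \<in> T" "\<And>j. j \<in> T \<Longrightarrow> t \<le> j" using finT S(3) by (simp_all add: t_def)
  have tm: "c \<le> t" "t < m" using t(1) S(2) by auto
  define d where "d = a i - b t"
  have B: "orient (a i) (b j) (b j') < 0" if "j < j'" "j' < m" for j j'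
    using ab that i unfolding avoiding_pair_def by blast
  have d: "cross2 d (b j) = orient (a i) (b j) (b t) + cross2 d (a i)" for j
    by (simp add: d_def orient_def cross2_def algebra_simps)
  show thesis
  proof (rule that[of d])
    fix j j' assume j: "j \<in> S" "j' \<in> T"
    have "orient (a i) (b j) (b t) < 0" using j S(1) tm by (intro B) auto
    moreover have "orient (a i) (b j') (b t) \<ge> 0"
    proof (cases "j' = t")
      case False
      then have "orient (a i) (b t) (b j') < 0" using t(2)[OF j(2)] j(2) S(2) by (intro B) auto
      then show ?thesis using orient_swap[of "a i" "b j'" "b t"] by linarith
    qed simp
    ultimately show "cross2 d (b j) < cross2 d (b j')" unfolding d by linarith
  qed
qed

text \<open>\<open>K\<close> is what \<open>mutually_avoiding_subsets\<close> needs for pairs of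
  size \<open>2 * n\<^sup>2\<close>. Half of the \<open>m * m\<close> rungs are
  \<open>n * (m * (2 * K + 2 * n))\<close>, so the unrelated ones average
  \<open>2 * K + 2 * n\<close> per vertex \<open>a i\<close>: \<open>2 * K\<close> are lost as
  noncentral and \<open>2 * n\<close> remain.\<close>

lemma no_large_avoiding_pair:
  assumes ab: "avoiding_pair m a b" and P: "\<And>i. i < m \<Longrightarrow> a i \<in> P \<and> b i \<in> P"
    and ne: "\<And>i j. i < m \<Longrightarrow> j < m \<Longrightarrow> a i \<noteq> b j"
    and K: "K = 16 * (2 * n\<^sup>2)\<^sup>2" and m: "m = 2 * n * (2 * K + 2 * n)"
  shows False
proof -
  have m0: "0 < m" using m n by simp
  define I where "I = (\<lambda>col. {(i, j). i < m \<and> j < m \<and> chi {a i, b j} = col})"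
  have sub: "I col \<subseteq> {..<m} \<times> {..<m}" for col by (auto simp: I_def)
  then have finI: "finite (I col)" for col by (meson finite_SigmaI finite_lessThan finite_subset)
  have "I True \<union> I False = {..<m} \<times> {..<m}" "I True \<inter> I False = {}" by (auto simp: I_def)
  then have "card (I True) + card (I False) = m * m"
    using card_Un_disjoint[OF finI finI, of True False] by simp
  then have sum: "card (I True) + card (I False) = 2 * (n * (m * (2 * K + 2 * n)))"
    using m by (simp add: algebra_simps)
  have "n * (m * (2 * K + 2 * n)) \<le> card (I True) \<or> n * (m * (2 * K + 2 * n)) \<le> card (I False)"
    using sum by linarith
  then obtain col where col: "n * (m * (2 * K + 2 * n)) \<le> card (I col)" by blast
  have pos: "0 < m * (2 * K + 2 * n)" using m0 n by simp
  \<comment> \<open>A rung \<open>f\<close> can follow \<open>e\<close> in a ladder of colour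
    \<open>col\<close>; \<open>n\<close> consecutive such rungs would be a forbidden copy.\<close>
  let ?R = "\<lambda>e f. fst e < fst f \<and> snd e < snd f \<and>
    chi {a (fst e), a (fst f)} = col \<and> chi {b (snd e), b (snd f)} = col"
  from chain_or_independent[OF finI col pos, of ?R] show False
  proof
    assume "\<exists>xs. length xs = n \<and> set xs \<subseteq> I col \<and> successively ?R xs"
    then obtain xs where xs: "length xs = n" "set xs \<subseteq> I col" "successively ?R xs" by blast
    define f g where "f = (\<lambda>i. fst (xs ! i))" and "g = (\<lambda>i. snd (xs ! i))"
    have step: "f i < f (Suc i) \<and> g i < g (Suc i) \<and> chi {a (f i), a (f (Suc i))} = col \<and>
        chi {b (g i), b (g (Suc i))} = col" if "Suc i < n" for i
      using xs(1,3) that by (simp add: successively_conv_nth f_def g_def)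
    have mem: "f i < m \<and> g i < m \<and> chi {a (f i), b (g i)} = col" if "i < n" for i
    proof -
      have "xs ! i \<in> I col" using xs(1,2) that nth_mem by blast
      then show ?thesis by (auto simp: I_def f_def g_def)
    qed
    have "f i < f j" "g i < g j" if "i < j" "j < n" for i j
      using transp_chain[of "(<)" n f i j] transp_chain[of "(<)" n g i j] step that by auto
    then have "avoiding_pair n (a \<circ> f) (b \<circ> g)" using mem by (intro avoiding_pair_sub[OF ab]) auto
    then have "\<exists>phi. mono_noncrossing_copy (ladder_V n) (ladder_E n) P chi phi"
      by (rule avoiding_pair_copy[where col = col]) (use mem step P ne in simp_all)
    then show False using no_copy by blast
  next
    assume "\<exists>D\<subseteq>I col. m * (2 * K + 2 * n) \<le> card D \<and> (\<forall>e\<in>D. \<forall>f\<in>D. \<not> ?R e f)"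
    then obtain D where D: "D \<subseteq> I col" "m * (2 * K + 2 * n) \<le> card D" "\<forall>e\<in>D. \<forall>f\<in>D. \<not> ?R e f" by blast
    define S where "S = (\<lambda>i. {j. (i, j) \<in> D})"
    have S: "S i \<subseteq> {..<m}" for i using D(1) by (auto simp: S_def I_def)
    have "D = Sigma {..<m} S" using D(1) by (auto simp: S_def I_def)
    moreover have "finite (S i)" for i using S finite_subset by blast
    ultimately have "card D = (\<Sum>i<m. card (S i))" by simp
    then obtain c where c: "2 * n \<le> card {i \<in> {..<m}. K \<le> card (S i \<inter> {..<c}) \<and> K \<le> card (S i \<inter> {c..})}"
      using common_central_element[of m S K "2 * n"] S D(2) m0 n by auto
    define A where "A = {i \<in> {..<m}. K \<le> card (S i \<inter> {..<c}) \<and> K \<le> card (S i \<inter> {c..})}"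
    have "inj_on a A" using avoiding_pair_inj(1)[OF ab] by (intro inj_onI) (auto simp: A_def)
    then have "2 * n \<le> card (a ` A)" using c by (simp add: card_image A_def)
    moreover have "a ` A \<subseteq> P" using P by (auto simp: A_def)
    \<comment> \<open>\<open>A\<close> collects the indices sharing the threshold \<open>c\<close>;
      it is large enough to contain an edge of colour \<open>col\<close>.\<close>
    ultimately obtain i0 j0 where "i0 \<in> A" "j0 \<in> A" "a i0 \<noteq> a j0" "chi {a i0, a j0} = col"
      using edge_of_colour[of "a ` A" col] by blast
    then have ij: "i0 \<in> A" "j0 \<in> A" "i0 \<noteq> j0" "chi {a i0, a j0} = col" "chi {a j0, a i0} = col"
      by (auto simp: insert_commute)
    obtain i i' where ii: "i \<in> A" "i' \<in> A" "i < i'" "chi {a i, a i'} = col"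
    proof (cases "i0 < j0")
      case True
      then show thesis using ij by (intro that)
    next
      case False
      then show thesis using ij by (intro that[of j0 i0]) simp_all
    qed
    have im: "i < m" using ii by (simp add: A_def)
    let ?S = "S i \<inter> {..<c}" and ?T = "S i' \<inter> {c..}"
    have K0: "0 < K" using K n by simp
    have cardK: "K \<le> card ?S" "K \<le> card ?T" using ii by (auto simp: A_def)
    have "?T \<subseteq> {c..<m}" using S[of i'] by auto
    moreover have "?T \<noteq> {}" using cardK K0 by force
    ultimately obtain d where d: "\<And>j j'. j \<in> ?S \<Longrightarrow> j' \<in> ?T \<Longrightarrow> cross2 d (b j) < cross2 d (b j')"
      using separated_classes[OF ab im, of ?S c ?T] by blast
    have injb: "inj_on b {..<m}" using avoiding_pair_inj(2)[OF ab] by (intro inj_onI) auto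
    have cardX: "card (b ` ?S) = card ?S" "card (b ` ?T) = card ?T"
      using S by (auto intro!: card_image inj_on_subset[OF injb])
    \<comment> \<open>The rungs \<open>(i, j)\<close> and \<open>(i', j')\<close> satisfy
      \<open>i < i'\<close>, \<open>j < c \<le> j'\<close>, and \<open>a i\<close>,
      \<open>a i'\<close> are joined in colour \<open>col\<close>; only the edge between
      \<open>b j\<close> and \<open>b j'\<close> can make them unrelated.\<close>
    have opp: "chi {x, y} = (\<not> col)" if xy: "x \<in> b ` ?S" "y \<in> b ` ?T" for x y
    proof -
      obtain j j' where j: "j \<in> ?S" "j' \<in> ?T" "x = b j" "y = b j'" using xy by blast
      then have "(i, j) \<in> D" "(i', j') \<in> D" "j < j'" by (auto simp: S_def)
      then have "\<not> ?R (i, j) (i', j')" using D(3) by blast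
      then show ?thesis using ii j \<open>j < j'\<close> by simp
    qed
    have sepX: "cross2 d x < cross2 d y" if "x \<in> b ` ?S" "y \<in> b ` ?T" for x y using d that by blast
    have XP: "b ` ?S \<subseteq> P" "b ` ?T \<subseteq> P" using P S[of i] S[of i'] by auto
    have "\<exists>a' b'. avoiding_pair (2 * n\<^sup>2) a' b' \<and>
      ((\<forall>i<2 * n\<^sup>2. a' i \<in> b ` ?S \<and> b' i \<in> b ` ?T) \<or> (\<forall>i<2 * n\<^sup>2. a' i \<in> b ` ?T \<and> b' i \<in> b ` ?S))"
    proof (rule mutually_avoiding_subsets[where d = d])
      show "finite (b ` ?S)" "finite (b ` ?T)" using XP finite_P finite_subset by blast+
      show "general_position (b ` ?S \<union> b ` ?T)" using XP by (intro general_position_subset[OF gp]) auto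
      show "16 * (2 * n\<^sup>2)\<^sup>2 \<le> card (b ` ?S)" "16 * (2 * n\<^sup>2)\<^sup>2 \<le> card (b ` ?T)"
        using cardX cardK K by simp_all
      show "0 < 2 * n\<^sup>2" using n by simp
    qed (rule sepX)
    then obtain a' b' where ab': "avoiding_pair (2 * n\<^sup>2) a' b'"
      "(\<forall>i<2 * n\<^sup>2. a' i \<in> b ` ?S \<and> b' i \<in> b ` ?T) \<or> (\<forall>i<2 * n\<^sup>2. a' i \<in> b ` ?T \<and> b' i \<in> b ` ?S)"
      by blast
    have opp': "chi {y, x} = (\<not> col)" if "x \<in> b ` ?S" "y \<in> b ` ?T" for x y
      using opp[OF that] by (simp add: insert_commute)
    show False
    proof (rule no_monochromatic_avoiding_pair[OF ab'(1), where col = "\<not> col"])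
      show "a' i \<in> P \<and> b' i \<in> P" if "i < 2 * n\<^sup>2" for i using ab'(2) that XP by blast
      show "a' i \<noteq> b' j" if "i < 2 * n\<^sup>2" "j < 2 * n\<^sup>2" for i j
      proof
        assume "a' i = b' j"
        then have "a' i \<in> b ` ?S \<and> a' i \<in> b ` ?T" using ab'(2) that by metis
        then show False using sepX[of "a' i" "a' i"] by simp
      qed
      show "n * (2 * n) \<le> 2 * n\<^sup>2" by (simp add: power2_eq_square)
      show "chi {a' i, b' j} = (\<not> col)" if "i < 2 * n\<^sup>2" "j < 2 * n\<^sup>2" for i j
        using ab'(2)
      proof
        assume "\<forall>i<2 * n\<^sup>2. a' i \<in> b ` ?S \<and> b' i \<in> b ` ?T"
        then show ?thesis using that by (intro opp) blast+
      next
        assume "\<forall>i<2 * n\<^sup>2. a' i \<in> b ` ?T \<and> b' i \<in> b ` ?S"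
        then show ?thesis using that by (intro opp') blast+
      qed
    qed
  qed
qed

end

text \<open>A generic direction splits the points into two separated halves of
  \<open>16 * m\<^sup>2\<close> points; injectivity of \<open>cross2 d\<close> makes the separation
  strict.\<close>

lemma geometric_ramsey_property_ladder:
  assumes n: "0 < n" and m: "m = 2 * n * (2 * (16 * (2 * n\<^sup>2)\<^sup>2) + 2 * n)"
  shows "geometric_ramsey_property (ladder_V n) (ladder_E n) (32 * m\<^sup>2)"
  unfolding geometric_ramsey_property_def
proof (intro allI impI, elim conjE, rule ccontr)
  fix P :: "point set" and chi
  assume P: "finite P" "card P = 32 * m\<^sup>2" "general_position P"
    and "\<not> (\<exists>phi. mono_noncrossing_copy (ladder_V n) (ladder_E n) P chi phi)"
  then interpret ladder_free n P chi using n by unfold_locales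
  have m0: "0 < m" using m n by simp
  obtain d where d: "inj_on (cross2 d) P" using injective_direction[OF P(1)] .
  obtain z where z: "\<And>i. i < card P \<Longrightarrow> z i \<in> P" "\<And>i j. i < card P \<Longrightarrow> j < card P \<Longrightarrow> z i = z j \<longleftrightarrow> i = j"
      "\<And>i j. i < j \<Longrightarrow> j < card P \<Longrightarrow> cross2 d (z i) \<le> cross2 d (z j)"
    using sorted_enumeration[OF P(1), of "cross2 d"] by blast
  let ?X = "z ` {..<16 * m\<^sup>2}" and ?Y = "z ` {16 * m\<^sup>2..<32 * m\<^sup>2}"
  have sub: "?X \<subseteq> P" "?Y \<subseteq> P" using z(1) P(2) by auto
  have sep: "cross2 d x < cross2 d y" if "x \<in> ?X" "y \<in> ?Y" for x y
  proof -
    obtain i j where ij: "i < 16 * m\<^sup>2" "16 * m\<^sup>2 \<le> j" "j < 32 * m\<^sup>2" "x = z i" "y = z j" using \<open>x \<in> ?X\<close> \<open>y \<in> ?Y\<close> by auto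
    then have "cross2 d x \<le> cross2 d y" "x \<noteq> y" using z(2)[of i j] z(3)[of i j] P(2) by auto
    moreover have "x \<in> P" "y \<in> P" using that sub by auto
    ultimately show ?thesis using d by (metis inj_onD order_le_less)
  qed
  have "inj_on z {..<card P}" using z(2) by (intro inj_onI) auto
  then have card: "card ?X = 16 * m\<^sup>2" "card ?Y = 16 * m\<^sup>2"
    using P(2) by (subst card_image; force intro: inj_on_subset)+
  have "\<exists>a b. avoiding_pair m a b \<and>
    ((\<forall>i<m. a i \<in> ?X \<and> b i \<in> ?Y) \<or> (\<forall>i<m. a i \<in> ?Y \<and> b i \<in> ?X))"
  proof (rule mutually_avoiding_subsets[where d = d])
    show "general_position (?X \<union> ?Y)" using sub by (intro general_position_subset[OF P(3)]) auto
    show "cross2 d x < cross2 d y" if "x \<in> ?X" "y \<in> ?Y" for x y by (rule sep[OF that])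
  qed (use card m0 in simp_all)
  then obtain a b where ab: "avoiding_pair m a b"
    "(\<forall>i<m. a i \<in> ?X \<and> b i \<in> ?Y) \<or> (\<forall>i<m. a i \<in> ?Y \<and> b i \<in> ?X)" by blast
  show False
  proof (rule no_large_avoiding_pair[OF ab(1) _ _ refl m])
    show "a i \<in> P \<and> b i \<in> P" if "i < m" for i using ab(2) that sub by blast
    show "a i \<noteq> b j" if "i < m" "j < m" for i j
    proof
      assume "a i = b j"
      then have "a i \<in> ?X \<and> a i \<in> ?Y" using ab(2) that by metis
      then show False using sep[of "a i" "a i"] by simp
    qed
  qed
qed

theorem mainTheorem7:
  shows "\<exists>c::real. \<forall>n::nat. n \<ge> 1 \<longrightarrow>
           real (geometric_ramsey (ladder_V n) (ladder_E n)) \<le> c * real n ^ 10"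
proof (intro exI allI impI)
  fix n :: nat
  assume n: "n \<ge> 1"
  define m where "m = 2 * n * (2 * (16 * (2 * n\<^sup>2)\<^sup>2) + 2 * n)"
  have "geometric_ramsey (ladder_V n) (ladder_E n) \<le> 32 * m\<^sup>2"
    unfolding geometric_ramsey_def
    using n m_def by (intro Least_le geometric_ramsey_property_ladder) auto
  \<comment> \<open>Expanding gives \<open>m = 256 * n ^ 5 + 4 * n\<^sup>2\<close>, and
    \<open>n \<ge> 1\<close> absorbs the second term. The final constant is
    \<open>32 * 260\<^sup>2 = 2163200\<close>.\<close>
  also have "m \<le> 260 * n ^ 5"
  proof -
    have "n\<^sup>2 \<le> n ^ 5" using n by (intro power_increasing) auto
    moreover have "(2 * n\<^sup>2)\<^sup>2 = 4 * n ^ 4" by (simp add: power_mult_distrib flip: power_mult)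
    then have "m = 256 * (n * n ^ 4) + 4 * (n * n)" by (simp add: m_def algebra_simps)
    moreover have "n * n ^ 4 = n ^ 5" "n * n = n\<^sup>2" by (simp_all add: eval_nat_numeral)
    ultimately show ?thesis by simp
  qed
  then have "32 * m\<^sup>2 \<le> 32 * (260 * n ^ 5)\<^sup>2" by (intro mult_left_mono power_mono) auto
  also have "\<dots> = 2163200 * n ^ 10" by (simp add: power_mult_distrib flip: power_mult)
  finally have "geometric_ramsey (ladder_V n) (ladder_E n) \<le> 2163200 * n ^ 10" .
  then have "real (geometric_ramsey (ladder_V n) (ladder_E n)) \<le> real (2163200 * n ^ 10)"
    by (rule of_nat_mono)
  then show "real (geometric_ramsey (ladder_V n) (ladder_E n)) \<le> 2163200 * real n ^ 10" by simp
qed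

end
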